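(* Let $(\Sigma,\sim,\pi,p)$ and $(\Sigma',\sim',\pi',p')$ be scaffoldings for a graph of group actions $\mathcal G$. Suppose $S_0$ and $S_0'$ are subtrees of $T_\Sigma$ and $T_{\Sigma'}$, respectively, and that $f\colon \Sigma_{S_0}\to\Sigma'_{S_0'}$ is an acceptable partial scaffolding isomorphism. Then $f$ can be extended to an acceptable scaffolding isomorphism $F\colon\Sigma\to\Sigma'$.
   Context: **Graphs.** A graph $\Gamma$ has a vertex set $V\Gamma$, an arc set $A\Gamma$, maps $o,t\colon A\Gamma\to V\Gamma$ (origin, terminus) and an involution $a\mapsto\bar a$ on arcs with $o(a)=t(\bar a)$; an arc with $\bar a=a$ is called self-reverse (loops with $\bar a\ne a$ are also allowed). Graph morphisms preserve $o$, $t$ and reversal. A tree is a connected graph without loops and without two arcs having the same origin and the same terminus, which has no simple cycles of length $\ge 3$. **Group actions.** A permutation group action $(G,X)$ is a faithful action of a group $G$ on a non-empty set $X$. For $Y\subseteq X$, $G^Y$ is the permutation group induced on $Y$ by the setwise stabiliser of $Y$ in $G$. An embedding $(H,Y)\hookrightarrow(G,X)$ of permutation group actions is given by an injection $\Phi\colon Y\to X$ such that $h\mapsto \Phi h\Phi^{-1}$ is an isomorphism from $H$ onto $G^{\Phi(Y)}$. **Graph of group actions (gga).** A gga $\mathcal G$ consists of: a connected graph $\Delta$ (base graph); for every $v\in V\Delta$ a permutation group action $(G(v),X(v))$; for every $a\in A\Delta$ a permutation group action $(H(a),Y(a))$ with $(H(\bar a),Y(\bar a))=(H(a),Y(a))$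 and an embedding $\Phi_a\colon(H(a),Y(a))\hookrightarrow(G(t(a)),X(t(a)))$; and for every self-reverse arc $a$ a permutation $h_a$ of $Y(a)$ with $h_aH(a)h_a^{-1}=H(a)$ and $h_a^2\in H(a)$ (inversion agent). An $a$-adhesion map is a map $g\Phi_a\colon Y(a)\to X(t(a))$ with $g\in G(t(a))$; its image is called an $a$-adhesion set. If $a$ is self-reverse, a twisted $a$-adhesion map is a map $g\Phi_ah_a$ with $g\in G(t(a))$. **Scaffolding.** A scaffolding $(\Sigma,\sim,\pi,p)$ for $\mathcal G$ is a graph $\Sigma$ with an equivalence relation $\sim$ on $V\Sigma$, extended to $A\Sigma$ by $a\sim a'$ iff $o(a)\sim o(a')$ and $t(a)\sim t(a')$ (write $[x]$ for the class of $x$ as a set, called a vertex or arc bundle, and $\llbracket x\rrbracket$ for the class as a vertex or arc of $T_\Sigma:=\Sigma/\!\sim$), such that: (i) $T_\Sigma$ is a tree; (ii) no arc of $\Sigma$ has both ends in the same vertex bundle; (iii) $\pi\colon T_\Sigma\to\Delta$ is a graph morphism; (iv) $p$ (a legal colouring) is a map from $V\Sigma\cup A\Sigma$ to $\bigcup_v X(v)\cup\bigcup_a Y(a)$ such that: $p$ restricts to bijections $[v]\to X(\pi(\llbracket v\rrbracket))$ and $[a]\to Y(\pi(\llbracket a\rrbracket))$ for all vertices $v$ and arcs $a$ of $\Sigma$; $p(\bar b)=p(b)$ for every arc $b$; if $\Psi_{\llbracket a\rrbracket}\colon Y(\pi(\llbracket a\rrbracket))\to X(\pi(t(\llbracket a\rrbracket)))$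 is the unique map with $\Psi_{\llbracket a\rrbracket}(p(b))=p(t(b))$ for all $b\in[a]$, then $\Psi_{\llbracket a\rrbracket}$ is a $\pi(\llbracket a\rrbracket)$-adhesion map when $\pi(\llbracket a\rrbracket)$ is not self-reverse, while when $\pi(\llbracket a\rrbracket)$ is self-reverse one of $\Psi_{\llbracket a\rrbracket},\Psi_{\llbracket\bar a\rrbracket}$ is a $\pi(\llbracket a\rrbracket)$-adhesion map and the other is a twisted $\pi(\llbracket a\rrbracket)$-adhesion map; and for every vertex $\llbracket v\rrbracket$ of $T_\Sigma$, every $b\in A\Delta$ with $t(b)=\pi(\llbracket v\rrbracket)$ and every $b$-adhesion set $S$, there is exactly one arc $\llbracket a\rrbracket$ of $T_\Sigma$ with $t(\llbracket a\rrbracket)=\llbracket v\rrbracket$, $\pi(\llbracket a\rrbracket)=b$ and $\Psi_{\llbracket a\rrbracket}(Y(b))=S$. **Acceptable maps.** For a subtree $S$ of $T_\Sigma$, $\Sigma_S$ is the subgraph of $\Sigma$ induced by $\bigcup_{\llbracket v\rrbracket\in VS}[v]$. A partial scaffolding isomorphism $f\colon\Sigma_S\to\Sigma'_{S'}$ is a graph isomorphism such that $x\sim y\iff f(x)\sim' f(y)$ and $\pi(\llbracket x\rrbracket)=\pi'(\llbracket f(x)\rrbracket)$ for all vertices and arcs $x,y$ of $\Sigma_S$; when $S=T_\Sigma$, $S'=T_{\Sigma'}$ it is called a scaffolding isomorphism. The local map of $f$ at $\llbracket v\rrbracket\in VS$ is the permutation $f_{\llbracket v\rrbracket}$ of $X(\pi(\llbracket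 v\rrbracket))$ with $f_{\llbracket v\rrbracket}(p(x))=p'(f(x))$ for all $x\in[v]$. $f$ is acceptable if $f_{\llbracket v\rrbracket}\in G(\pi(\llbracket v\rrbracket))$ for every $\llbracket v\rrbracket\in VS$. *)

theory Defs
  imports
    "Graph_Theory.Digraph_Component"
    "Graph_Theory.Arc_Walk"
    "HOL-Algebra.Group_Action"
begin

section \<open>Graphs\<close>

text \<open>
  A digraph of the library together with an arc reversal.  Fixed points of the reversal are
  allowed; the library's bidirected digraphs exclude them.
\<close>

record ('v, 'a) rgraph =
  dg :: "('v, 'a) pre_digraph"
  rev_arc :: "'a \<Rightarrow> 'a"

abbreviation vertices :: "('v, 'a) rgraph \<Rightarrow> 'v set" where
  "vertices \<Gamma> \<equiv> verts (dg \<Gamma>)"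

abbreviation arrows :: "('v, 'a) rgraph \<Rightarrow> 'a set" where
  "arrows \<Gamma> \<equiv> arcs (dg \<Gamma>)"

abbreviation origin :: "('v, 'a) rgraph \<Rightarrow> 'a \<Rightarrow> 'v" where
  "origin \<Gamma> \<equiv> tail (dg \<Gamma>)"

abbreviation terminus :: "('v, 'a) rgraph \<Rightarrow> 'a \<Rightarrow> 'v" where
  "terminus \<Gamma> \<equiv> head (dg \<Gamma>)"

definition is_graph :: "('v, 'a) rgraph \<Rightarrow> bool" where
  "is_graph \<Gamma> \<longleftrightarrow> wf_digraph (dg \<Gamma>) \<and>
     (\<forall>a \<in> arrows \<Gamma>. rev_arc \<Gamma> a \<in> arrows \<Gamma> \<and> rev_arc \<Gamma> (rev_arc \<Gamma> a) = a \<and>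
        origin \<Gamma> a = terminus \<Gamma> (rev_arc \<Gamma> a))"

definition self_reverse :: "('v, 'a) rgraph \<Rightarrow> 'a \<Rightarrow> bool" where
  "self_reverse \<Gamma> a \<longleftrightarrow> rev_arc \<Gamma> a = a"

text \<open>
  The library's connectedness includes non-emptiness, and its cycles include the walk that
  traverses an arc and its reverse, which the length bound excludes.
\<close>

definition is_tree :: "('v, 'a) rgraph \<Rightarrow> bool" where
  "is_tree \<Gamma> \<longleftrightarrow> is_graph \<Gamma> \<and> Digraph_Component.connected (dg \<Gamma>) \<and>
     loopfree_digraph (dg \<Gamma>) \<and> nomulti_digraph (dg \<Gamma>) \<and>
     \<not> (\<exists>c. pre_digraph.cycle (dg \<Gamma>) c \<and> 3 \<le> length c)"

definition is_subgraph :: "('v, 'a) rgraph \<Rightarrow> ('v, 'a) rgraph \<Rightarrow> bool" where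
  "is_subgraph S \<Gamma> \<longleftrightarrow> is_graph S \<and> is_graph \<Gamma> \<and> subgraph (dg S) (dg \<Gamma>) \<and>
     (\<forall>a \<in> arrows S. rev_arc S a = rev_arc \<Gamma> a)"

definition is_subtree :: "('v, 'a) rgraph \<Rightarrow> ('v, 'a) rgraph \<Rightarrow> bool" where
  "is_subtree S \<Gamma> \<longleftrightarrow> is_subgraph S \<Gamma> \<and> is_tree S"

definition induced_rgraph :: "('v, 'a) rgraph \<Rightarrow> 'v set \<Rightarrow> ('v, 'a) rgraph" where
  "induced_rgraph \<Gamma> W =
     \<lparr>dg = \<lparr>verts = W, arcs = {a \<in> arrows \<Gamma>. origin \<Gamma> a \<in> W \<and> terminus \<Gamma> a \<in> W},
            tail = origin \<Gamma>, head = terminus \<Gamma>\<rparr>,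
      rev_arc = rev_arc \<Gamma>\<rparr>"

text \<open>Morphisms are given by a map on vertices and a map on arcs.\<close>

definition graph_morphism ::
  "('v, 'a) rgraph \<Rightarrow> ('w, 'b) rgraph \<Rightarrow> ('v \<Rightarrow> 'w) \<Rightarrow> ('a \<Rightarrow> 'b) \<Rightarrow> bool" where
  "graph_morphism \<Gamma> \<Gamma>' fV fA \<longleftrightarrow>
     fV ` vertices \<Gamma> \<subseteq> vertices \<Gamma>' \<and> fA ` arrows \<Gamma> \<subseteq> arrows \<Gamma>' \<and>
     (\<forall>a \<in> arrows \<Gamma>. origin \<Gamma>' (fA a) = fV (origin \<Gamma> a) \<and> terminus \<Gamma>' (fA a) = fV (terminus \<Gamma> a) \<and>
        rev_arc \<Gamma>' (fA a) = fA (rev_arc \<Gamma> a))"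

definition graph_isomorphism ::
  "('v, 'a) rgraph \<Rightarrow> ('w, 'b) rgraph \<Rightarrow> ('v \<Rightarrow> 'w) \<Rightarrow> ('a \<Rightarrow> 'b) \<Rightarrow> bool" where
  "graph_isomorphism \<Gamma> \<Gamma>' fV fA \<longleftrightarrow> graph_morphism \<Gamma> \<Gamma>' fV fA \<and>
     bij_betw fV (vertices \<Gamma>) (vertices \<Gamma>') \<and> bij_betw fA (arrows \<Gamma>) (arrows \<Gamma>')"


section \<open>Permutation group actions\<close>

record ('g, 'x) paction =
  grp :: "'g monoid"
  pts :: "'x set"
  act :: "'g \<Rightarrow> 'x \<Rightarrow> 'x"

definition perm_action :: "('g, 'x) paction \<Rightarrow> bool" where
  "perm_action P \<longleftrightarrow> faithful_action (grp P) (pts P) (act P) \<and> pts P \<noteq> {}"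

text \<open>
  The group of a faithful action, viewed as a set of permutations.  As in the library,
  permutations of a set are extensional functions.
\<close>

definition perms :: "('g, 'x) paction \<Rightarrow> ('x \<Rightarrow> 'x) set" where
  "perms P = act P ` carrier (grp P)"

definition setwise_stabiliser :: "('g, 'x) paction \<Rightarrow> 'x set \<Rightarrow> 'g set" where
  "setwise_stabiliser P Z = {g \<in> carrier (grp P). act P g ` Z = Z}"

definition induced_perm_group :: "('g, 'x) paction \<Rightarrow> 'x set \<Rightarrow> ('x \<Rightarrow> 'x) monoid" where
  "induced_perm_group P Z =
     (BijGroup Z)\<lparr>carrier := (\<lambda>g. restrict (act P g) Z) ` setwise_stabiliser P Z\<rparr>"

definition action_embedding ::
  "('h, 'y) paction \<Rightarrow> ('g, 'x) paction \<Rightarrow> ('y \<Rightarrow> 'x) \<Rightarrow> bool" where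
  "action_embedding Q P \<Phi> \<longleftrightarrow> inj_on \<Phi> (pts Q) \<and> \<Phi> ` pts Q \<subseteq> pts P \<and>
     (\<lambda>h. \<lambda>x \<in> \<Phi> ` pts Q. \<Phi> (act Q h (inv_into (pts Q) \<Phi> x)))
       \<in> iso (grp Q) (induced_perm_group P (\<Phi> ` pts Q))"


section \<open>Graphs of group actions\<close>

record ('dv, 'da, 'g, 'x, 'h, 'y) gga =
  base :: "('dv, 'da) rgraph"
  vact :: "'dv \<Rightarrow> ('g, 'x) paction"
  aact :: "'da \<Rightarrow> ('h, 'y) paction"
  emb :: "'da \<Rightarrow> 'y \<Rightarrow> 'x"
  agent :: "'da \<Rightarrow> 'y \<Rightarrow> 'y"

definition inversion_agent :: "('h, 'y) paction \<Rightarrow> ('y \<Rightarrow> 'y) \<Rightarrow> bool" where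
  "inversion_agent Q k \<longleftrightarrow>
     (let B = BijGroup (pts Q) in
        k \<in> carrier B \<and>
        (\<lambda>h. k \<otimes>\<^bsub>B\<^esub> h \<otimes>\<^bsub>B\<^esub> inv\<^bsub>B\<^esub> k) ` perms Q = perms Q \<and>
        k \<otimes>\<^bsub>B\<^esub> k \<in> perms Q)"

definition is_gga :: "('dv, 'da, 'g, 'x, 'h, 'y) gga \<Rightarrow> bool" where
  "is_gga \<G> \<longleftrightarrow>
     is_graph (base \<G>) \<and> Digraph_Component.connected (dg (base \<G>)) \<and>
     (\<forall>v \<in> vertices (base \<G>). perm_action (vact \<G> v)) \<and>
     (\<forall>a \<in> arrows (base \<G>).
        perm_action (aact \<G> a) \<and>
        aact \<G> (rev_arc (base \<G>) a) = aact \<G> a \<and>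
        action_embedding (aact \<G> a) (vact \<G> (terminus (base \<G>) a)) (emb \<G> a) \<and>
        (self_reverse (base \<G>) a \<longrightarrow> inversion_agent (aact \<G> a) (agent \<G> a)))"

abbreviation vpts :: "('dv, 'da, 'g, 'x, 'h, 'y) gga \<Rightarrow> 'dv \<Rightarrow> 'x set" where
  "vpts \<G> v \<equiv> pts (vact \<G> v)"

abbreviation apts :: "('dv, 'da, 'g, 'x, 'h, 'y) gga \<Rightarrow> 'da \<Rightarrow> 'y set" where
  "apts \<G> a \<equiv> pts (aact \<G> a)"

definition adhesion_maps ::
  "('dv, 'da, 'g, 'x, 'h, 'y) gga \<Rightarrow> 'da \<Rightarrow> ('y \<Rightarrow> 'x) set" where
  "adhesion_maps \<G> a =
     (\<lambda>g. compose (apts \<G> a) g (emb \<G> a)) ` perms (vact \<G> (terminus (base \<G>) a))"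

definition twisted_adhesion_maps ::
  "('dv, 'da, 'g, 'x, 'h, 'y) gga \<Rightarrow> 'da \<Rightarrow> ('y \<Rightarrow> 'x) set" where
  "twisted_adhesion_maps \<G> a =
     (\<lambda>g. compose (apts \<G> a) g (compose (apts \<G> a) (emb \<G> a) (agent \<G> a)))
       ` perms (vact \<G> (terminus (base \<G>) a))"

definition adhesion_sets ::
  "('dv, 'da, 'g, 'x, 'h, 'y) gga \<Rightarrow> 'da \<Rightarrow> 'x set set" where
  "adhesion_sets \<G> a = (\<lambda>\<psi>. \<psi> ` apts \<G> a) ` adhesion_maps \<G> a"


section \<open>Scaffoldings\<close>

text \<open>
  The projection \<open>\<pi>\<close> and the colouring \<open>p\<close> are split into their vertex and arc parts.
  A vertex or arc of the quotient graph is the corresponding bundle.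
\<close>

record ('v, 'a, 'dv, 'da, 'x, 'y) scaf =
  gr :: "('v, 'a) rgraph"
  sim :: "('v \<times> 'v) set"
  piV :: "'v set \<Rightarrow> 'dv"
  piA :: "'a set \<Rightarrow> 'da"
  colV :: "'v \<Rightarrow> 'x"
  colA :: "'a \<Rightarrow> 'y"

definition arc_sim :: "('v, 'a, 'dv, 'da, 'x, 'y) scaf \<Rightarrow> ('a \<times> 'a) set" where
  "arc_sim \<Sigma> = {(a, b). a \<in> arrows (gr \<Sigma>) \<and> b \<in> arrows (gr \<Sigma>) \<and>
     (origin (gr \<Sigma>) a, origin (gr \<Sigma>) b) \<in> sim \<Sigma> \<and> (terminus (gr \<Sigma>) a, terminus (gr \<Sigma>) b) \<in> sim \<Sigma>}"

abbreviation vbundle :: "('v, 'a, 'dv, 'da, 'x, 'y) scaf \<Rightarrow> 'v \<Rightarrow> 'v set" where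
  "vbundle \<Sigma> v \<equiv> sim \<Sigma> `` {v}"

abbreviation abundle :: "('v, 'a, 'dv, 'da, 'x, 'y) scaf \<Rightarrow> 'a \<Rightarrow> 'a set" where
  "abundle \<Sigma> a \<equiv> arc_sim \<Sigma> `` {a}"

text \<open>
  The origins of the arcs in one bundle are all equivalent, so the set of vertices equivalent
  to one of them is a single vertex bundle; likewise for termini.
\<close>

definition quot :: "('v, 'a, 'dv, 'da, 'x, 'y) scaf \<Rightarrow> ('v set, 'a set) rgraph" where
  "quot \<Sigma> =
     \<lparr>dg = \<lparr>verts = vertices (gr \<Sigma>) // sim \<Sigma>, arcs = arrows (gr \<Sigma>) // arc_sim \<Sigma>,
            tail = (\<lambda>A. sim \<Sigma> `` (origin (gr \<Sigma>) ` A)), head = (\<lambda>A. sim \<Sigma> `` (terminus (gr \<Sigma>) ` A))\<rparr>,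
      rev_arc = (\<lambda>A. rev_arc (gr \<Sigma>) ` A)\<rparr>"

lemma equiv_arc_sim:
  assumes "is_graph (gr \<Sigma>)" and "equiv (vertices (gr \<Sigma>)) (sim \<Sigma>)"
  shows "equiv (arrows (gr \<Sigma>)) (arc_sim \<Sigma>)"
proof (rule equivI)
  show "arc_sim \<Sigma> \<subseteq> arrows (gr \<Sigma>) \<times> arrows (gr \<Sigma>)"
    by (auto simp: arc_sim_def)
  show "refl_on (arrows (gr \<Sigma>)) (arc_sim \<Sigma>)"
    using assms
    by (auto simp: arc_sim_def is_graph_def equiv_def refl_on_def wf_digraph_def)
  show "sym (arc_sim \<Sigma>)" "trans (arc_sim \<Sigma>)"
    using assms(2) unfolding arc_sim_def equiv_def sym_def trans_def by blast+
qed

lemma quot_abundle: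
  assumes "is_graph (gr \<Sigma>)" and "equiv (vertices (gr \<Sigma>)) (sim \<Sigma>)" and "a \<in> arrows (gr \<Sigma>)"
  shows "origin (quot \<Sigma>) (abundle \<Sigma> a) = vbundle \<Sigma> (origin (gr \<Sigma>) a)"
    and "terminus (quot \<Sigma>) (abundle \<Sigma> a) = vbundle \<Sigma> (terminus (gr \<Sigma>) a)"
    and "rev_arc (quot \<Sigma>) (abundle \<Sigma> a) = abundle \<Sigma> (rev_arc (gr \<Sigma>) a)"
proof -
  have self: "(a, a) \<in> arc_sim \<Sigma>"
    using equiv_arc_sim[OF assms(1,2)] assms(3) by (simp add: equiv_def refl_on_def)
  have tr: "trans (sim \<Sigma>)" using assms(2) by (simp add: equiv_def)
  show "origin (quot \<Sigma>) (abundle \<Sigma> a) = vbundle \<Sigma> (origin (gr \<Sigma>) a)"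
    using self tr by (auto simp: quot_def arc_sim_def dest: transD)
  show "terminus (quot \<Sigma>) (abundle \<Sigma> a) = vbundle \<Sigma> (terminus (gr \<Sigma>) a)"
    using self tr by (auto simp: quot_def arc_sim_def dest: transD)
  have r: "rev_arc (gr \<Sigma>) b \<in> arrows (gr \<Sigma>)" "rev_arc (gr \<Sigma>) (rev_arc (gr \<Sigma>) b) = b"
    "terminus (gr \<Sigma>) (rev_arc (gr \<Sigma>) b) = origin (gr \<Sigma>) b"
    "origin (gr \<Sigma>) (rev_arc (gr \<Sigma>) b) = terminus (gr \<Sigma>) b"
    if "b \<in> arrows (gr \<Sigma>)" for b
    using assms(1) that unfolding is_graph_def by metis+
  show "rev_arc (quot \<Sigma>) (abundle \<Sigma> a) = abundle \<Sigma> (rev_arc (gr \<Sigma>) a)"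
  proof (intro equalityI subsetI)
    fix b assume "b \<in> rev_arc (quot \<Sigma>) (abundle \<Sigma> a)"
    then show "b \<in> abundle \<Sigma> (rev_arc (gr \<Sigma>) a)"
      using r assms(3) by (auto simp: quot_def arc_sim_def)
  next
    fix b assume b: "b \<in> abundle \<Sigma> (rev_arc (gr \<Sigma>) a)"
    then have "rev_arc (gr \<Sigma>) b \<in> abundle \<Sigma> a" "rev_arc (gr \<Sigma>) (rev_arc (gr \<Sigma>) b) = b"
      using r assms(3) by (auto simp: arc_sim_def)
    then show "b \<in> rev_arc (quot \<Sigma>) (abundle \<Sigma> a)"
      unfolding quot_def by (metis image_eqI rgraph.select_convs(2))
  qed
qed

text \<open>
  The map \<open>\<Psi>\<close> determined by \<open>\<Psi> (p b) = p (t b)\<close> for all \<open>b\<close> in an arc bundle; see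
  \<open>bundle_map_unique\<close>.
\<close>

definition bundle_map ::
  "('dv, 'da, 'g, 'x, 'h, 'y) gga \<Rightarrow> ('v, 'a, 'dv, 'da, 'x, 'y) scaf \<Rightarrow> 'a set \<Rightarrow> 'y \<Rightarrow> 'x" where
  "bundle_map \<G> \<Sigma> A =
     (\<lambda>y \<in> apts \<G> (piA \<Sigma> A). colV \<Sigma> (terminus (gr \<Sigma>) (inv_into A (colA \<Sigma>) y)))"

lemma bundle_map_unique:
  assumes "bij_betw (colA \<Sigma>) A (apts \<G> (piA \<Sigma> A))"
    and "\<psi> \<in> extensional (apts \<G> (piA \<Sigma> A))"
  shows "\<psi> = bundle_map \<G> \<Sigma> A \<longleftrightarrow> (\<forall>b \<in> A. \<psi> (colA \<Sigma> b) = colV \<Sigma> (terminus (gr \<Sigma>) b))"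
proof
  assume "\<psi> = bundle_map \<G> \<Sigma> A"
  then show "\<forall>b \<in> A. \<psi> (colA \<Sigma> b) = colV \<Sigma> (terminus (gr \<Sigma>) b)"
    using assms(1) by (auto simp: bundle_map_def bij_betw_def)
next
  assume h: "\<forall>b \<in> A. \<psi> (colA \<Sigma> b) = colV \<Sigma> (terminus (gr \<Sigma>) b)"
  have "\<psi> y = bundle_map \<G> \<Sigma> A y" if y: "y \<in> apts \<G> (piA \<Sigma> A)" for y
  proof -
    let ?b = "inv_into A (colA \<Sigma>) y"
    have "?b \<in> A"
      using assms(1) y by (simp add: bij_betw_def inv_into_into)
    moreover have "colA \<Sigma> ?b = y"
      using assms(1) y by (simp add: bij_betw_def f_inv_into_f)
    ultimately show ?thesis
      using bspec[OF h, of ?b] y by (simp add: bundle_map_def)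
  qed
  then show "\<psi> = bundle_map \<G> \<Sigma> A"
    using assms(2) by (intro extensionalityI) (auto simp: bundle_map_def)
qed

definition legal_colouring ::
  "('dv, 'da, 'g, 'x, 'h, 'y) gga \<Rightarrow> ('v, 'a, 'dv, 'da, 'x, 'y) scaf \<Rightarrow> bool" where
  "legal_colouring \<G> \<Sigma> \<longleftrightarrow>
     (\<forall>V \<in> vertices (quot \<Sigma>). bij_betw (colV \<Sigma>) V (vpts \<G> (piV \<Sigma> V))) \<and>
     (\<forall>A \<in> arrows (quot \<Sigma>). bij_betw (colA \<Sigma>) A (apts \<G> (piA \<Sigma> A))) \<and>
     (\<forall>b \<in> arrows (gr \<Sigma>). colA \<Sigma> (rev_arc (gr \<Sigma>) b) = colA \<Sigma> b) \<and>
     (\<forall>A \<in> arrows (quot \<Sigma>).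
        let a = piA \<Sigma> A; \<psi> = bundle_map \<G> \<Sigma> A;
            \<psi>' = bundle_map \<G> \<Sigma> (rev_arc (quot \<Sigma>) A)
        in if self_reverse (base \<G>) a
           then (\<psi> \<in> adhesion_maps \<G> a \<and> \<psi>' \<in> twisted_adhesion_maps \<G> a) \<or>
                (\<psi>' \<in> adhesion_maps \<G> a \<and> \<psi> \<in> twisted_adhesion_maps \<G> a)
           else \<psi> \<in> adhesion_maps \<G> a) \<and>
     (\<forall>V \<in> vertices (quot \<Sigma>). \<forall>b \<in> arrows (base \<G>). terminus (base \<G>) b = piV \<Sigma> V \<longrightarrow>
        (\<forall>S \<in> adhesion_sets \<G> b.
           \<exists>!A. A \<in> arrows (quot \<Sigma>) \<and> terminus (quot \<Sigma>) A = V \<and> piA \<Sigma> A = b \<and>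
                bundle_map \<G> \<Sigma> A ` apts \<G> b = S))"

definition is_scaffolding ::
  "('dv, 'da, 'g, 'x, 'h, 'y) gga \<Rightarrow> ('v, 'a, 'dv, 'da, 'x, 'y) scaf \<Rightarrow> bool" where
  "is_scaffolding \<G> \<Sigma> \<longleftrightarrow>
     is_graph (gr \<Sigma>) \<and> equiv (vertices (gr \<Sigma>)) (sim \<Sigma>) \<and>
     is_tree (quot \<Sigma>) \<and>
     (\<forall>a \<in> arrows (gr \<Sigma>). (origin (gr \<Sigma>) a, terminus (gr \<Sigma>) a) \<notin> sim \<Sigma>) \<and>
     graph_morphism (quot \<Sigma>) (base \<G>) (piV \<Sigma>) (piA \<Sigma>) \<and>
     legal_colouring \<G> \<Sigma>"


section \<open>Acceptable maps\<close>

text \<open>The subgraph of \<open>\<Sigma>\<close> lying over a subtree of the quotient.\<close>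

definition over ::
  "('v, 'a, 'dv, 'da, 'x, 'y) scaf \<Rightarrow> ('v set, 'a set) rgraph \<Rightarrow> ('v, 'a) rgraph" where
  "over \<Sigma> S = induced_rgraph (gr \<Sigma>) (\<Union> (vertices S))"

definition partial_scaffolding_iso ::
  "('v, 'a, 'dv, 'da, 'x, 'y) scaf \<Rightarrow> ('v set, 'a set) rgraph \<Rightarrow>
   ('w, 'b, 'dv, 'da, 'x, 'y) scaf \<Rightarrow> ('w set, 'b set) rgraph \<Rightarrow>
   ('v \<Rightarrow> 'w) \<Rightarrow> ('a \<Rightarrow> 'b) \<Rightarrow> bool" where
  "partial_scaffolding_iso \<Sigma> S \<Sigma>' S' fV fA \<longleftrightarrow>
     graph_isomorphism (over \<Sigma> S) (over \<Sigma>' S') fV fA \<and>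
     (\<forall>x \<in> vertices (over \<Sigma> S). \<forall>y \<in> vertices (over \<Sigma> S).
        (x, y) \<in> sim \<Sigma> \<longleftrightarrow> (fV x, fV y) \<in> sim \<Sigma>') \<and>
     (\<forall>x \<in> arrows (over \<Sigma> S). \<forall>y \<in> arrows (over \<Sigma> S).
        (x, y) \<in> arc_sim \<Sigma> \<longleftrightarrow> (fA x, fA y) \<in> arc_sim \<Sigma>') \<and>
     (\<forall>x \<in> vertices (over \<Sigma> S). piV \<Sigma> (vbundle \<Sigma> x) = piV \<Sigma>' (vbundle \<Sigma>' (fV x))) \<and>
     (\<forall>x \<in> arrows (over \<Sigma> S). piA \<Sigma> (abundle \<Sigma> x) = piA \<Sigma>' (abundle \<Sigma>' (fA x)))"

definition scaffolding_iso ::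
  "('v, 'a, 'dv, 'da, 'x, 'y) scaf \<Rightarrow> ('w, 'b, 'dv, 'da, 'x, 'y) scaf \<Rightarrow>
   ('v \<Rightarrow> 'w) \<Rightarrow> ('a \<Rightarrow> 'b) \<Rightarrow> bool" where
  "scaffolding_iso \<Sigma> \<Sigma>' fV fA \<longleftrightarrow>
     partial_scaffolding_iso \<Sigma> (quot \<Sigma>) \<Sigma>' (quot \<Sigma>') fV fA"

definition local_map ::
  "('dv, 'da, 'g, 'x, 'h, 'y) gga \<Rightarrow> ('v, 'a, 'dv, 'da, 'x, 'y) scaf \<Rightarrow>
   ('w, 'b, 'dv, 'da, 'x, 'y) scaf \<Rightarrow> ('v \<Rightarrow> 'w) \<Rightarrow> 'v set \<Rightarrow> 'x \<Rightarrow> 'x" where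
  "local_map \<G> \<Sigma> \<Sigma>' fV V =
     (\<lambda>z \<in> vpts \<G> (piV \<Sigma> V). colV \<Sigma>' (fV (inv_into V (colV \<Sigma>) z)))"

lemma local_map_colV:
  assumes "bij_betw (colV \<Sigma>) V (vpts \<G> (piV \<Sigma> V))" and "x \<in> V"
  shows "local_map \<G> \<Sigma> \<Sigma>' fV V (colV \<Sigma> x) = colV \<Sigma>' (fV x)"
  using assms by (auto simp: local_map_def bij_betw_def)

definition acceptable ::
  "('dv, 'da, 'g, 'x, 'h, 'y) gga \<Rightarrow> ('v, 'a, 'dv, 'da, 'x, 'y) scaf \<Rightarrow>
   ('v set, 'a set) rgraph \<Rightarrow> ('w, 'b, 'dv, 'da, 'x, 'y) scaf \<Rightarrow> ('v \<Rightarrow> 'w) \<Rightarrow> bool" where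
  "acceptable \<G> \<Sigma> S \<Sigma>' fV \<longleftrightarrow>
     (\<forall>V \<in> vertices S. local_map \<G> \<Sigma> \<Sigma>' fV V \<in> perms (vact \<G> (piV \<Sigma> V)))"

end

theory Submission
  imports Defs
begin

text \<open>
  Extend \<open>f\<close> along an arc \<open>A\<close> of \<open>T\<^bsub>\<Sigma>\<^esub>\<close> that leaves its domain at \<open>W = t(A)\<close>.  The local map \<open>h\<close> at \<open>W\<close> sends
  the adhesion set of \<open>A\<close> to an adhesion set, which belongs to exactly one arc \<open>A'\<close> at \<open>f(W)\<close> over the
  same arc \<open>a\<close> of the base graph, and \<open>h\<close> induces a permutation \<open>k = \<Psi>\<^bsub>A'\<^esub>\<^sup>-\<^sup>1 h \<Psi>\<^bsub>A\<^esub>\<close> of the colours of \<open>A\<close>.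
  Up to inversion agents, \<open>k\<close> lies in \<open>H(a)\<close>, which is also the group of the reversed arc, so the
  embedding at the origin extends it to a local map there.  Trees have no cycles, so no other arc
  constrains the new vertex, and Zorn's lemma gives a map defined on all of \<open>\<Sigma>\<close>.  It is onto because
  at every vertex each adhesion set is realised by one arc only.
\<close>

section \<open>Permutation group actions\<close>

text \<open>The partial map is stored as a set of triples: a vertex bundle, its image bundle and the
  local map between them. This loses nothing: the colouring recovers the map on vertices from the
  local maps, and since the maps \<Psi> are injective, an arc is determined by its two ends.
  Compatibility becomes a condition on pairs of triples, so it passes to unions of chains.

  The delicate case is a self-reverse base arc. One end of a bundle then carries a twisted map, and
  \<open>A\<close> and \<open>A'\<close> may carry the twist at different ends. So \<open>k\<close>
  lies either in H(a) or in the coset t H(a) of the inversion agent t. What has to lie in H(a) is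
  \<open>k\<close> with the twists of the origin stripped off, and t H(a) t^(-1) = H(a) together
  with t^2 in H(a) gives exactly that. The local map at the new vertex is then a choice among all
  extensions of an element of H(a).\<close>

lemma perms_bij: "\<lbrakk>perm_action P; g \<in> perms P\<rbrakk> \<Longrightarrow> bij_betw g (pts P) (pts P)"
  unfolding perm_action_def perms_def faithful_action_def group_action_def group_hom_def
    group_hom_axioms_def hom_def BijGroup_def Bij_def
  by auto

lemma perms_extensional: "\<lbrakk>perm_action P; g \<in> perms P\<rbrakk> \<Longrightarrow> g \<in> extensional (pts P)"
  unfolding perm_action_def perms_def faithful_action_def group_action_def group_hom_def
    group_hom_axioms_def hom_def BijGroup_def Bij_def
  by auto

lemma perms_compose:
  assumes "perm_action P" "g \<in> perms P" "h \<in> perms P"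
  shows "compose (pts P) g h \<in> perms P"
proof -
  interpret group_hom "grp P" "BijGroup (pts P)" "act P"
    using assms(1) unfolding perm_action_def faithful_action_def group_action_def by auto
  obtain x y where xy: "x \<in> carrier (grp P)" "g = act P x" "y \<in> carrier (grp P)" "h = act P y"
    using assms unfolding perms_def by auto
  have "act P x \<in> Bij (pts P)" "act P y \<in> Bij (pts P)"
    using hom_closed[OF xy(1)] hom_closed[OF xy(3)] by (auto simp: BijGroup_def)
  then have "act P (x \<otimes>\<^bsub>grp P\<^esub> y) = compose (pts P) g h"
    using hom_mult[OF xy(1,3)] xy by (simp add: BijGroup_def)
  moreover have "x \<otimes>\<^bsub>grp P\<^esub> y \<in> carrier (grp P)" using xy by auto
  ultimately show ?thesis unfolding perms_def by (metis imageI)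
qed

lemma perms_inverse:
  assumes "perm_action P" "g \<in> perms P"
  obtains g' where "g' \<in> perms P" "\<And>x. x \<in> pts P \<Longrightarrow> g' (g x) = x" "\<And>x. x \<in> pts P \<Longrightarrow> g (g' x) = x"
proof -
  interpret group_hom "grp P" "BijGroup (pts P)" "act P"
    using assms(1) unfolding perm_action_def faithful_action_def group_action_def by auto
  obtain x where x: "x \<in> carrier (grp P)" "g = act P x"
    using assms unfolding perms_def by auto
  have b: "g \<in> Bij (pts P)"
    using hom_closed[OF x(1)] x by (auto simp: BijGroup_def)
  have "act P (inv\<^bsub>grp P\<^esub> x) = (\<lambda>z \<in> pts P. inv_into (pts P) g z)"
    using hom_inv[OF x(1)] x inv_BijGroup[OF b] by simp
  moreover have "inv\<^bsub>grp P\<^esub> x \<in> carrier (grp P)" using x by auto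
  ultimately have "(\<lambda>z \<in> pts P. inv_into (pts P) g z) \<in> perms P" unfolding perms_def by (metis imageI)
  moreover have "bij_betw g (pts P) (pts P)" using b by (auto simp: Bij_def)
  then have "inv_into (pts P) g (g x) = x" "g (inv_into (pts P) g x) = x" "g x \<in> pts P" if "x \<in> pts P" for x
    using that by (auto simp: bij_betw_def f_inv_into_f)
  ultimately show ?thesis by (intro that[of "\<lambda>z \<in> pts P. inv_into (pts P) g z"]) auto
qed

section \<open>Passing between arc groups and vertex groups\<close>

text \<open>An element of the group induced on the image of \<Phi> is by definition the restriction
  of an element of the setwise stabiliser; any such element serves, and it need not be unique. This
  is the passage from an arc to the vertex at its far end.\<close>

lemma embedding_extend:
  assumes "action_embedding Q P \<Phi>" "\<eta> \<in> perms Q"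
  obtains g where "g \<in> perms P" "\<And>y. y \<in> pts Q \<Longrightarrow> g (\<Phi> y) = \<Phi> (\<eta> y)"
proof -
  obtain q where q: "q \<in> carrier (grp Q)" "\<eta> = act Q q" using assms(2) by (auto simp: perms_def)
  let ?c = "\<lambda>h. \<lambda>x \<in> \<Phi> ` pts Q. \<Phi> (act Q h (inv_into (pts Q) \<Phi> x))"
  have "?c q \<in> carrier (induced_perm_group P (\<Phi> ` pts Q))"
    using assms(1) q by (auto simp: action_embedding_def iso_def bij_betw_def)
  then obtain x where x: "x \<in> carrier (grp P)" "?c q = restrict (act P x) (\<Phi> ` pts Q)"
    by (auto simp: induced_perm_group_def setwise_stabiliser_def)
  show ?thesis
  proof (rule that[of "act P x"])
    show "act P x \<in> perms P" using x by (simp add: perms_def)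
    fix y assume y: "y \<in> pts Q"
    then show "act P x (\<Phi> y) = \<Phi> (\<eta> y)"
      using fun_cong[OF x(2), of "\<Phi> y"] q assms(1) by (simp add: action_embedding_def)
  qed
qed

text \<open>Here the isomorphism onto the induced group is used in its surjective direction. It
  brings the local map at the known vertex down to the colours of an arc.\<close>

lemma embedding_restrict:
  assumes "action_embedding Q P \<Phi>" "g \<in> perms P" "g ` \<Phi> ` pts Q = \<Phi> ` pts Q"
  obtains \<eta> where "\<eta> \<in> perms Q" "\<And>y. y \<in> pts Q \<Longrightarrow> g (\<Phi> y) = \<Phi> (\<eta> y)"
proof -
  obtain x where x: "x \<in> carrier (grp P)" "g = act P x" using assms(2) by (auto simp: perms_def)
  let ?c = "\<lambda>h. \<lambda>x \<in> \<Phi> ` pts Q. \<Phi> (act Q h (inv_into (pts Q) \<Phi> x))"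
  have "restrict g (\<Phi> ` pts Q) \<in> carrier (induced_perm_group P (\<Phi> ` pts Q))"
    using x assms(3) by (auto simp: induced_perm_group_def setwise_stabiliser_def)
  moreover have "carrier (induced_perm_group P (\<Phi> ` pts Q)) = ?c ` carrier (grp Q)"
    using assms(1) by (auto simp: action_embedding_def iso_def bij_betw_def)
  ultimately obtain q where q: "q \<in> carrier (grp Q)" "restrict g (\<Phi> ` pts Q) = ?c q" by auto
  show ?thesis
  proof (rule that[of "act Q q"])
    show "act Q q \<in> perms Q" using q by (simp add: perms_def)
    fix y assume y: "y \<in> pts Q"
    then show "g (\<Phi> y) = \<Phi> (act Q q y)"
      using fun_cong[OF q(2), of "\<Phi> y"] assms(1) by (simp add: action_embedding_def)
  qed
qed

lemma inversion_agent_bij: "inversion_agent Q k \<Longrightarrow> bij_betw k (pts Q) (pts Q)"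
  by (auto simp: inversion_agent_def Let_def BijGroup_def Bij_def)

lemma inversion_agent_square:
  assumes "inversion_agent Q k"
  obtains \<eta> where "\<eta> \<in> perms Q" "\<And>y. y \<in> pts Q \<Longrightarrow> k (k y) = \<eta> y"
proof -
  have "k \<in> Bij (pts Q)" "k \<otimes>\<^bsub>BijGroup (pts Q)\<^esub> k \<in> perms Q"
    using assms by (auto simp: inversion_agent_def Let_def BijGroup_def)
  then have "compose (pts Q) k k \<in> perms Q" by (simp add: BijGroup_def)
  then show ?thesis by (rule that) (simp add: compose_eq)
qed

text \<open>The two inclusions of k H k^(-1) = H, read pointwise: the image of \<eta> under
  conjugation lies in H, and \<eta> is itself such an image.\<close>

lemma
  assumes Q: "perm_action Q" and ag: "inversion_agent Q k" and \<eta>: "\<eta> \<in> perms Q"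
  shows inversion_agent_push: "\<exists>\<theta> \<in> perms Q. \<forall>y \<in> pts Q. k (\<eta> y) = \<theta> (k y)"
    and inversion_agent_pull: "\<exists>\<theta> \<in> perms Q. \<forall>y \<in> pts Q. \<eta> (k y) = k (\<theta> y)"
proof -
  let ?B = "BijGroup (pts Q)"
  have k: "k \<in> Bij (pts Q)"
    using ag by (auto simp: inversion_agent_def Let_def BijGroup_def)
  have im: "(\<lambda>h. k \<otimes>\<^bsub>?B\<^esub> h \<otimes>\<^bsub>?B\<^esub> inv\<^bsub>?B\<^esub> k) ` perms Q = perms Q"
    using ag by (auto simp: inversion_agent_def Let_def)
  have Bij: "h \<in> Bij (pts Q)" if "h \<in> perms Q" for h
    using perms_bij[OF Q that] perms_extensional[OF Q that] by (simp add: Bij_def)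
  have kb: "bij_betw k (pts Q) (pts Q)" using k by (simp add: Bij_def)
  have conj: "(k \<otimes>\<^bsub>?B\<^esub> h \<otimes>\<^bsub>?B\<^esub> inv\<^bsub>?B\<^esub> k) (k y) = k (h y)"
    if h: "h \<in> perms Q" and y: "y \<in> pts Q" for h y
  proof -
    have "restrict (inv_into (pts Q) k) (pts Q) \<in> Bij (pts Q)" by (rule restrict_inv_into_Bij[OF k])
    moreover have "k y \<in> pts Q" "inv_into (pts Q) k (k y) = y"
      using kb y by (auto simp: bij_betw_def)
    moreover have "compose (pts Q) k h \<in> Bij (pts Q)" using k Bij[OF h] by (rule compose_Bij)
    moreover have "inv\<^bsub>?B\<^esub> k = restrict (inv_into (pts Q) k) (pts Q)"
      using inv_BijGroup[OF k] by (simp add: restrict_def)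
    ultimately have "k \<otimes>\<^bsub>?B\<^esub> h \<otimes>\<^bsub>?B\<^esub> inv\<^bsub>?B\<^esub> k =
        compose (pts Q) (compose (pts Q) k h) (restrict (inv_into (pts Q) k) (pts Q))"
      using k Bij[OF h] by (simp add: BijGroup_def)
    then show ?thesis
      using \<open>k y \<in> pts Q\<close> \<open>inv_into (pts Q) k (k y) = y\<close> y by (simp add: compose_eq)
  qed
  show "\<exists>\<theta> \<in> perms Q. \<forall>y \<in> pts Q. k (\<eta> y) = \<theta> (k y)"
  proof (intro bexI ballI)
    show "k \<otimes>\<^bsub>?B\<^esub> \<eta> \<otimes>\<^bsub>?B\<^esub> inv\<^bsub>?B\<^esub> k \<in> perms Q" using im \<eta> by blast
  qed (simp add: conj[OF \<eta>])
  from im \<eta> obtain \<theta> where "\<theta> \<in> perms Q" "\<eta> = k \<otimes>\<^bsub>?B\<^esub> \<theta> \<otimes>\<^bsub>?B\<^esub> inv\<^bsub>?B\<^esub> k" by blast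
  then show "\<exists>\<theta> \<in> perms Q. \<forall>y \<in> pts Q. \<eta> (k y) = k (\<theta> y)"
    using conj by auto
qed

section \<open>Adhesion maps\<close>

text \<open>The colouring condition of an arc bundle and of its reverse in one statement, with
  \<psi> at the terminus and \<open>\<psi>'\<close> at the origin. Away from self-reverse arcs the
  clause of a legal colouring speaks of one end only; the second conjunct is that clause for the
  reversed bundle.\<close>

definition legal_pair ::
  "('dv, 'da, 'g, 'x, 'h, 'y) gga \<Rightarrow> 'da \<Rightarrow> ('y \<Rightarrow> 'x) \<Rightarrow> ('y \<Rightarrow> 'x) \<Rightarrow> bool" where
  "legal_pair \<G> a \<psi> \<psi>' \<longleftrightarrow>
     (if self_reverse (base \<G>) a
      then (\<psi> \<in> adhesion_maps \<G> a \<and> \<psi>' \<in> twisted_adhesion_maps \<G> a) \<or>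
           (\<psi>' \<in> adhesion_maps \<G> a \<and> \<psi> \<in> twisted_adhesion_maps \<G> a)
      else \<psi> \<in> adhesion_maps \<G> a \<and> \<psi>' \<in> adhesion_maps \<G> (rev_arc (base \<G>) a))"

text \<open>A bijection between two arc bundles is seen through the permutation \<open>k\<close> of
  arc colours that it induces. One \<open>k\<close> has to serve both ends, since an arc and its
  reverse have the same colour: \<open>h\<close> is the local map at the terminus, \<open>g\<close>
  the one at the origin.\<close>

definition colour_compatible ::
  "'y set \<Rightarrow> ('y \<Rightarrow> 'x) \<Rightarrow> ('y \<Rightarrow> 'x) \<Rightarrow> ('x \<Rightarrow> 'x) \<Rightarrow> ('y \<Rightarrow> 'x) \<Rightarrow> ('y \<Rightarrow> 'x) \<Rightarrow> ('x \<Rightarrow> 'x) \<Rightarrow> bool"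
  where
  "colour_compatible Y \<psi> \<chi> h \<psi>' \<chi>' g \<longleftrightarrow>
     (\<exists>k. bij_betw k Y Y \<and> (\<forall>y \<in> Y. h (\<psi> y) = \<chi> (k y) \<and> g (\<psi>' y) = \<chi>' (k y)))"

lemma colour_compatible_swap: "colour_compatible Y \<psi> \<chi> h \<psi>' \<chi>' g \<Longrightarrow> colour_compatible Y \<psi>' \<chi>' g \<psi> \<chi> h"
  unfolding colour_compatible_def by blast

lemma colour_compatible_image:
  assumes "colour_compatible Y \<psi> \<chi> h \<psi>' \<chi>' g"
  shows "h ` \<psi> ` Y = \<chi> ` Y"
proof -
  obtain k where k: "bij_betw k Y Y" "\<And>y. y \<in> Y \<Longrightarrow> h (\<psi> y) = \<chi> (k y)"
    using assms by (auto simp: colour_compatible_def)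
  then have "h ` \<psi> ` Y = \<chi> ` k ` Y" by (simp add: image_image)
  then show ?thesis using k(1) by (simp add: bij_betw_def)
qed

text \<open>A common normal form \<psi> = g \<Phi> u for adhesion maps and twisted adhesion maps. It
  lets the extension step be a single computation, with the distribution of the twists confined to
  \<open>agent_double_coset\<close>.\<close>

lemma legal_pairE:
  assumes "legal_pair \<G> a \<psi> \<psi>'"
  obtains g u g' u' where
    "g \<in> perms (vact \<G> (terminus (base \<G>) a))"
    "g' \<in> perms (vact \<G> (terminus (base \<G>) (rev_arc (base \<G>) a)))"
    "\<And>y. y \<in> apts \<G> a \<Longrightarrow> \<psi> y = g (emb \<G> a (u y))"
    "\<And>y. y \<in> apts \<G> (rev_arc (base \<G>) a) \<Longrightarrow> \<psi>' y = g' (emb \<G> (rev_arc (base \<G>) a) (u' y))"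
    "u = id \<and> u' = id \<and> \<not> self_reverse (base \<G>) a \<or>
     self_reverse (base \<G>) a \<and> (u = id \<and> u' = agent \<G> a \<or> u = agent \<G> a \<and> u' = id)"
proof (cases "self_reverse (base \<G>) a")
  case True
  then have "rev_arc (base \<G>) a = a" by (simp add: self_reverse_def)
  consider "\<psi> \<in> adhesion_maps \<G> a" "\<psi>' \<in> twisted_adhesion_maps \<G> a"
    | "\<psi>' \<in> adhesion_maps \<G> a" "\<psi> \<in> twisted_adhesion_maps \<G> a"
    using assms True by (auto simp: legal_pair_def)
  then show ?thesis
  proof cases
    case 1
    then obtain g g' where "g \<in> perms (vact \<G> (terminus (base \<G>) a))"
      "g' \<in> perms (vact \<G> (terminus (base \<G>) a))"
      "\<psi> = compose (apts \<G> a) g (emb \<G> a)"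
      "\<psi>' = compose (apts \<G> a) g' (compose (apts \<G> a) (emb \<G> a) (agent \<G> a))"
      by (auto simp: adhesion_maps_def twisted_adhesion_maps_def)
    then show ?thesis
      using True \<open>rev_arc (base \<G>) a = a\<close>
      by (intro that[of g g' id "agent \<G> a"]) (auto simp: compose_eq)
  next
    case 2
    then obtain g g' where "g \<in> perms (vact \<G> (terminus (base \<G>) a))"
      "g' \<in> perms (vact \<G> (terminus (base \<G>) a))"
      "\<psi>' = compose (apts \<G> a) g' (emb \<G> a)"
      "\<psi> = compose (apts \<G> a) g (compose (apts \<G> a) (emb \<G> a) (agent \<G> a))"
      by (auto simp: adhesion_maps_def twisted_adhesion_maps_def)
    then show ?thesis
      using True \<open>rev_arc (base \<G>) a = a\<close>
      by (intro that[of g g' "agent \<G> a" id]) (auto simp: compose_eq)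
  qed
next
  case False
  then obtain g g' where "g \<in> perms (vact \<G> (terminus (base \<G>) a))"
    "g' \<in> perms (vact \<G> (terminus (base \<G>) (rev_arc (base \<G>) a)))"
    "\<psi> = compose (apts \<G> a) g (emb \<G> a)"
    "\<psi>' = compose (apts \<G> (rev_arc (base \<G>) a)) g' (emb \<G> (rev_arc (base \<G>) a))"
    using assms by (auto simp: adhesion_maps_def legal_pair_def)
  then show ?thesis using False by (intro that[of g g' id id]) (auto simp: compose_eq)
qed

lemma gga_arcD:
  assumes "is_gga \<G>" "a \<in> arrows (base \<G>)"
  shows "rev_arc (base \<G>) a \<in> arrows (base \<G>)"
    and "rev_arc (base \<G>) (rev_arc (base \<G>) a) = a"
    and "terminus (base \<G>) (rev_arc (base \<G>) a) = origin (base \<G>) a"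
    and "aact \<G> (rev_arc (base \<G>) a) = aact \<G> a"
    and "perm_action (aact \<G> a)"
    and "perm_action (vact \<G> (terminus (base \<G>) a))"
    and "action_embedding (aact \<G> a) (vact \<G> (terminus (base \<G>) a)) (emb \<G> a)"
    and "self_reverse (base \<G>) a \<Longrightarrow> inversion_agent (aact \<G> a) (agent \<G> a)"
  using assms unfolding is_gga_def is_graph_def wf_digraph_def by metis+

text \<open>
  Here \<open>k = v\<^sup>-\<^sup>1 \<eta> u\<close>, so \<open>v' k u'\<^sup>-\<^sup>1\<close> is one of \<open>t\<^sup>\<plusminus>\<^sup>1 \<eta> t\<^sup>\<plusminus>\<^sup>1\<close>; it lies in \<open>H\<close> because \<open>t\<close> normalises \<open>H\<close>
  and \<open>t\<^sup>2 \<in> H\<close>.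
\<close>

lemma agent_double_coset:
  assumes Q: "perm_action Q" and ag: "inversion_agent Q t" and \<eta>: "\<eta> \<in> perms Q"
    and kY: "bij_betw k (pts Q) (pts Q)"
    and u: "u = id \<and> u' = t \<or> u = t \<and> u' = id"
    and v: "v = id \<and> v' = t \<or> v = t \<and> v' = id"
    and vk: "\<And>y. y \<in> pts Q \<Longrightarrow> v (k y) = \<eta> (u y)"
  shows "\<exists>\<theta> \<in> perms Q. \<forall>y \<in> pts Q. v' (k y) = \<theta> (u' y)"
proof -
  let ?Y = "pts Q"
  have t: "t y \<in> ?Y" if "y \<in> ?Y" for y
    using inversion_agent_bij[OF ag] that by (auto simp: bij_betw_def)
  have tinj: "t x = t y \<Longrightarrow> x = y" if "x \<in> ?Y" "y \<in> ?Y" for x y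
    using inversion_agent_bij[OF ag] that by (auto simp: bij_betw_def inj_on_def)
  have P: "\<theta> y \<in> ?Y" if "y \<in> ?Y" "\<theta> \<in> perms Q" for y \<theta>
    using perms_bij[OF Q that(2)] that by (auto simp: bij_betw_def)
  have kc: "k y \<in> ?Y" if "y \<in> ?Y" for y using kY that by (auto simp: bij_betw_def)
  obtain \<sigma> where \<sigma>: "\<sigma> \<in> perms Q" "\<And>y. y \<in> ?Y \<Longrightarrow> t (t y) = \<sigma> y"
    using inversion_agent_square[OF ag] by blast
  consider "u = id" "u' = t" "v = id" "v' = t" | "u = t" "u' = id" "v = t" "v' = id"
    | "u = id" "u' = t" "v = t" "v' = id" | "u = t" "u' = id" "v = id" "v' = t"
    using u v by blast
  then show ?thesis
  proof cases
    case 1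
    then show ?thesis using inversion_agent_push[OF Q ag \<eta>] vk by simp
  next
    case 2
    obtain \<theta> where \<theta>: "\<theta> \<in> perms Q" "\<And>y. y \<in> ?Y \<Longrightarrow> \<eta> (t y) = t (\<theta> y)"
      using inversion_agent_pull[OF Q ag \<eta>] by blast
    have "k y = \<theta> y" if "y \<in> ?Y" for y
      using vk[OF that] \<theta>(2)[OF that] 2 tinj[OF kc[OF that] P[OF that \<theta>(1)]] by simp
    then show ?thesis using \<theta>(1) 2 by auto
  next
    case 3
    obtain \<theta> where \<theta>: "\<theta> \<in> perms Q" "\<And>y. y \<in> ?Y \<Longrightarrow> t (\<eta> y) = \<theta> (t y)"
      using inversion_agent_push[OF Q ag \<eta>] by blast
    obtain \<sigma>' where \<sigma>': "\<sigma>' \<in> perms Q" "\<And>y. y \<in> ?Y \<Longrightarrow> \<sigma>' (\<sigma> y) = y"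
      by (rule perms_inverse[OF Q \<sigma>(1)]) (rule that)
    \<comment> \<open>Here t k = \<eta>. Applying \<open>t\<close> once more gives t^2 k = t \<eta>
      = \<theta> t, and t^2 = \<sigma> can be inverted inside H.\<close>
    have "\<sigma> (k y) = \<theta> (t y)" if "y \<in> ?Y" for y
      using vk[OF that] \<theta>(2)[OF that] \<sigma>(2)[OF kc[OF that]] 3 by simp
    then have "k y = compose ?Y \<sigma>' \<theta> (t y)" if "y \<in> ?Y" for y
      using \<sigma>'(2)[OF kc[OF that]] t that by (simp add: compose_eq)
    then show ?thesis using perms_compose[OF Q \<sigma>'(1) \<theta>(1)] 3 by auto
  next
    case 4
    obtain \<theta> where \<theta>: "\<theta> \<in> perms Q" "\<And>y. y \<in> ?Y \<Longrightarrow> t (\<eta> y) = \<theta> (t y)"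
      using inversion_agent_push[OF Q ag \<eta>] by blast
    \<comment> \<open>Here k = \<eta> t, so t k = (t \<eta> t^(-1)) t^2, a product of two elements
      of H.\<close>
    have "t (k y) = compose ?Y \<theta> \<sigma> y" if "y \<in> ?Y" for y
      using vk[OF that] \<theta>(2)[OF t[OF that]] \<sigma>(2)[OF that] 4 that by (simp add: compose_eq)
    then show ?thesis using perms_compose[OF Q \<theta>(1) \<sigma>(1)] 4 by auto
  qed
qed

text \<open>With \<psi> = g \<Phi> u and \<chi> = f \<Phi> v, the map f^(-1) h g stabilises the
  image of \<Phi> and so comes from some \<eta> in H(a). Reversal keeps H(a), so the element that
  corresponds to \<eta> at the other end extends to the vertex group of the origin through the
  embedding of the reversed arc.\<close>

lemma legal_pair_extend:
  assumes \<G>: "is_gga \<G>" and a: "a \<in> arrows (base \<G>)"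
    and \<psi>: "legal_pair \<G> a \<psi> \<psi>'" and \<chi>: "legal_pair \<G> a \<chi> \<chi>'"
    and h: "h \<in> perms (vact \<G> (terminus (base \<G>) a))"
    and im: "h ` \<psi> ` apts \<G> a = \<chi> ` apts \<G> a"
  shows "\<exists>g \<in> perms (vact \<G> (origin (base \<G>) a)). colour_compatible (apts \<G> a) \<psi> \<chi> h \<psi>' \<chi>' g"
proof -
  let ?r = "rev_arc (base \<G>) a"
  let ?P = "vact \<G> (terminus (base \<G>) a)" and ?P' = "vact \<G> (terminus (base \<G>) ?r)"
  let ?Q = "aact \<G> a" and ?Y = "apts \<G> a"
  let ?\<Phi> = "emb \<G> a" and ?\<Phi>' = "emb \<G> ?r"
  note D = gga_arcD[OF \<G> a]
  have P: "perm_action ?P" and Q: "perm_action ?Q" and P': "perm_action ?P'"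
    using D gga_arcD(6)[OF \<G> D(1)] by auto
  have E: "action_embedding ?Q ?P ?\<Phi>" and E': "action_embedding ?Q ?P' ?\<Phi>'"
    using D gga_arcD(7)[OF \<G> D(1)] by auto
  have \<Phi>: "?\<Phi> y \<in> pts ?P" "?\<Phi>' y \<in> pts ?P'" if "y \<in> ?Y" for y
    using E E' that by (auto simp: action_embedding_def)
  obtain g u g' u' where \<psi>D: "g \<in> perms ?P" "g' \<in> perms ?P'"
    "\<And>y. y \<in> ?Y \<Longrightarrow> \<psi> y = g (?\<Phi> (u y))" "\<And>y. y \<in> ?Y \<Longrightarrow> \<psi>' y = g' (?\<Phi>' (u' y))"
    and u: "u = id \<and> u' = id \<and> \<not> self_reverse (base \<G>) a \<or>
      self_reverse (base \<G>) a \<and> (u = id \<and> u' = agent \<G> a \<or> u = agent \<G> a \<and> u' = id)"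
    by (rule legal_pairE[OF \<psi>, unfolded D(4)]) (rule that)
  obtain f v f' v' where \<chi>D: "f \<in> perms ?P" "f' \<in> perms ?P'"
    "\<And>y. y \<in> ?Y \<Longrightarrow> \<chi> y = f (?\<Phi> (v y))" "\<And>y. y \<in> ?Y \<Longrightarrow> \<chi>' y = f' (?\<Phi>' (v' y))"
    and v: "v = id \<and> v' = id \<and> \<not> self_reverse (base \<G>) a \<or>
      self_reverse (base \<G>) a \<and> (v = id \<and> v' = agent \<G> a \<or> v = agent \<G> a \<and> v' = id)"
    by (rule legal_pairE[OF \<chi>, unfolded D(4)]) (rule that)
  have bij: "bij_betw u ?Y ?Y" "bij_betw u' ?Y ?Y" "bij_betw v ?Y ?Y" "bij_betw v' ?Y ?Y"
    using u v inversion_agent_bij[OF D(8)] by auto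
  obtain f1 where f1: "f1 \<in> perms ?P" "\<And>x. x \<in> pts ?P \<Longrightarrow> f1 (f x) = x" "\<And>x. x \<in> pts ?P \<Longrightarrow> f (f1 x) = x"
    by (rule perms_inverse[OF P \<chi>D(1)]) (rule that)
  obtain g1 where g1: "g1 \<in> perms ?P'" "\<And>x. x \<in> pts ?P' \<Longrightarrow> g1 (g' x) = x"
    by (rule perms_inverse[OF P' \<psi>D(2)]) (rule that)
  have closed: "q x \<in> pts ?P" if "q \<in> perms ?P" "x \<in> pts ?P" for q x
    using perms_bij[OF P that(1)] that by (auto simp: bij_betw_def)
  have closed': "q x \<in> pts ?P'" if "q \<in> perms ?P'" "x \<in> pts ?P'" for q x
    using perms_bij[OF P' that(1)] that by (auto simp: bij_betw_def)
  have "\<psi> ` ?Y = g ` ?\<Phi> ` u ` ?Y" "\<chi> ` ?Y = f ` ?\<Phi> ` v ` ?Y"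
    using \<psi>D(3) \<chi>D(3) by (simp_all add: image_image)
  \<comment> \<open>The twists \<open>u\<close> and \<open>v\<close> permute the colours, so they
    disappear from the images.\<close>
  then have im': "h ` g ` ?\<Phi> ` ?Y = f ` ?\<Phi> ` ?Y"
    using im bij by (simp add: bij_betw_def)
  let ?q = "compose (pts ?P) f1 (compose (pts ?P) h g)"
  have q: "?q \<in> perms ?P" by (intro perms_compose P f1 h \<psi>D)
  have "?q ` ?\<Phi> ` ?Y = f1 ` h ` g ` ?\<Phi> ` ?Y"
    using \<Phi> by (force simp: compose_eq image_image)
  also have "\<dots> = ?\<Phi> ` ?Y"
    unfolding im' using \<Phi> f1 by (force simp: image_image)
  finally obtain \<eta> where \<eta>: "\<eta> \<in> perms ?Q" "\<And>y. y \<in> ?Y \<Longrightarrow> ?q (?\<Phi> y) = ?\<Phi> (\<eta> y)"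
    using embedding_restrict[OF E q] by blast
  have hg: "h (g (?\<Phi> y)) = f (?\<Phi> (\<eta> y))" if "y \<in> ?Y" for y
  proof -
    have "f (f1 (h (g (?\<Phi> y)))) = h (g (?\<Phi> y))"
      using \<Phi>[OF that] closed h \<psi>D f1 by auto
    then show ?thesis using \<eta>(2)[OF that] \<Phi>[OF that] by (simp add: compose_eq)
  qed
  \<comment> \<open>Forced by h \<psi> = \<chi> k: cancelling f \<Phi> leaves v k = \<eta>
    u.\<close>
  define k where "k = (\<lambda>y. inv_into ?Y v (\<eta> (u y)))"
  have \<eta>b: "bij_betw \<eta> ?Y ?Y" by (rule perms_bij[OF Q \<eta>(1)])
  have k: "bij_betw k ?Y ?Y"
    using bij_betw_trans[OF bij_betw_trans[OF bij(1) \<eta>b] bij_betw_inv_into[OF bij(3)]]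
    by (simp add: k_def comp_def)
  have vk: "v (k y) = \<eta> (u y)" if "y \<in> ?Y" for y
  proof -
    have "\<eta> (u y) \<in> v ` ?Y"
      using bij_betwE[OF bij(1)] bij_betwE[OF \<eta>b] bij_betw_imp_surj_on[OF bij(3)] that by simp
    then show ?thesis by (simp add: k_def f_inv_into_f)
  qed
  \<comment> \<open>The twists at the origin are \<open>u'\<close> and \<open>v'\<close>, and
    \<theta> is v' k u'^(-1) on the colours. On an arc that is not self-reverse all twists are
    trivial and \<theta> = \<eta>.\<close>
  obtain \<theta> where \<theta>: "\<theta> \<in> perms ?Q" "\<And>y. y \<in> ?Y \<Longrightarrow> v' (k y) = \<theta> (u' y)"
  proof (cases "self_reverse (base \<G>) a")
    case True
    then show ?thesis
      using agent_double_coset[where u = u and v = v and u' = u' and v' = v', OF Q D(8)[OF True] \<eta>(1) k _ _ vk] u v that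
      by auto
  next
    case False
    then show ?thesis using that \<eta>(1) vk u v by auto
  qed
  obtain e where e: "e \<in> perms ?P'" "\<And>y. y \<in> ?Y \<Longrightarrow> e (?\<Phi>' y) = ?\<Phi>' (\<theta> y)"
    using embedding_extend[OF E' \<theta>(1)] by blast
  \<comment> \<open>Undo \<open>g'\<close>, act by the extension \<open>e\<close> of \<theta>,
    reapply \<open>f'\<close>: this turns \<open>\<psi>' y\<close> into
    \<open>\<chi>' (k y)\<close>.\<close>
  let ?g = "compose (pts ?P') f' (compose (pts ?P') e g1)"
  have "h (\<psi> y) = \<chi> (k y) \<and> ?g (\<psi>' y) = \<chi>' (k y)" if y: "y \<in> ?Y" for y
  proof -
    have Y: "u y \<in> ?Y" "u' y \<in> ?Y" "k y \<in> ?Y" using y bij k by (auto simp: bij_betw_def)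
    have "?g (\<psi>' y) = f' (e (?\<Phi>' (u' y)))"
      using Y \<psi>D(4)[OF y] g1(2) \<Phi>(2)[OF Y(2)] closed'[OF \<psi>D(2)] by (simp add: compose_eq)
    then show ?thesis
      using \<psi>D(3)[OF y] \<chi>D(3,4)[OF Y(3)] hg[OF Y(1)] vk[OF y] e(2)[OF Y(2)] \<theta>(2)[OF y] by simp
  qed
  moreover have "?g \<in> perms ?P'" by (intro perms_compose P' \<chi>D e g1)
  ultimately show ?thesis using k D(3) unfolding colour_compatible_def by auto
qed

section \<open>Trees\<close>

lemma is_graph_wf: "is_graph \<Gamma> \<Longrightarrow> wf_digraph (dg \<Gamma>)"
  by (simp add: is_graph_def)

lemma is_graph_revD:
  assumes "is_graph \<Gamma>" "a \<in> arrows \<Gamma>"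
  shows "rev_arc \<Gamma> a \<in> arrows \<Gamma>" "rev_arc \<Gamma> (rev_arc \<Gamma> a) = a"
    "origin \<Gamma> (rev_arc \<Gamma> a) = terminus \<Gamma> a" "terminus \<Gamma> (rev_arc \<Gamma> a) = origin \<Gamma> a"
  using assms unfolding is_graph_def by metis+

text \<open>Every arc has a reverse, so adjacency is symmetric. The directed form is the one that
  the later path arguments use.\<close>

lemma is_graph_connected:
  assumes "is_graph \<Gamma>" "Digraph_Component.connected (dg \<Gamma>)"
  shows "strongly_connected (dg \<Gamma>)"
proof (rule wf_digraph.symmetric_connected_imp_strongly_connected)
  show "symmetric (dg \<Gamma>)"
    unfolding symmetric_def sym_def arcs_ends_conv using is_graph_revD[OF assms(1)] by force
qed (use assms in \<open>auto simp: is_graph_def\<close>)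

lemma reachable_induce_subgraph_mono:
  assumes "u \<rightarrow>\<^sup>*\<^bsub>G \<restriction> D\<^esub> v" "D \<subseteq> E"
  shows "u \<rightarrow>\<^sup>*\<^bsub>G \<restriction> E\<^esub> v"
proof -
  have "arcs_ends (G \<restriction> D) \<subseteq> arcs_ends (G \<restriction> E)"
    using assms(2) by (auto simp: arcs_ends_conv)
  then show ?thesis
    using assms unfolding reachable_def by (auto intro: rtrancl_on_mono)
qed

lemma reachable_image:
  assumes "wf_digraph G" "wf_digraph H" and "x \<rightarrow>\<^sup>*\<^bsub>G\<^esub> y"
    and "\<And>v. v \<in> verts G \<Longrightarrow> f v \<in> verts H"
    and "\<And>u v. (u, v) \<in> arcs_ends G \<Longrightarrow> (f u, f v) \<in> arcs_ends H"
  shows "f x \<rightarrow>\<^sup>*\<^bsub>H\<^esub> f y"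
  using assms(3)
proof (induction rule: wf_digraph.converse_reachable_induct[OF assms(1), consumes 1, case_names base step])
  case base
  then show ?case using assms(4) by (simp add: wf_digraph.reachable_refl[OF assms(2)])
next
  case (step u v)
  then show ?case using assms(5) wf_digraph.adj_reachable_trans[OF assms(2)] by blast
qed

text \<open>Two different arcs from an outside vertex into the connected set \<open>D\<close> would
  close up, along a path inside \<open>D\<close>, to a cycle. This is what leaves a newly added
  vertex bundle constrained by one arc only.\<close>

lemma tree_unique_neighbour:
  assumes \<Gamma>: "is_tree \<Gamma>" and D: "D \<subseteq> vertices \<Gamma>" "strongly_connected (dg \<Gamma> \<restriction> D)"
    and a: "a \<in> arrows \<Gamma>" "origin \<Gamma> a \<notin> D" "terminus \<Gamma> a \<in> D"
    and b: "b \<in> arrows \<Gamma>" "origin \<Gamma> b = origin \<Gamma> a" "terminus \<Gamma> b \<in> D"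
  shows "a = b"
proof (rule ccontr)
  assume ab: "a \<noteq> b"
  interpret nomulti_digraph "dg \<Gamma>" using \<Gamma> by (simp add: is_tree_def)
  have g: "is_graph \<Gamma>" using \<Gamma> by (simp add: is_tree_def)
  interpret I: wf_digraph "dg \<Gamma> \<restriction> D" by (rule wellformed_induce_subgraph)
  have ne: "terminus \<Gamma> a \<noteq> terminus \<Gamma> b"
    using no_multi_arcs[OF a(1) b(1)] ab b(2) by (auto simp: arc_to_ends_def)
  have "terminus \<Gamma> a \<rightarrow>\<^sup>*\<^bsub>dg \<Gamma> \<restriction> D\<^esub> terminus \<Gamma> b"
    using D(2) a(3) b(3) by (auto simp: strongly_connected_def)
  then obtain p where "I.apath (terminus \<Gamma> a) p (terminus \<Gamma> b)"
    using I.reachable_apath by blast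
  then have p: "I.awalk (terminus \<Gamma> a) p (terminus \<Gamma> b)" "distinct (I.awalk_verts (terminus \<Gamma> a) p)"
    by (auto simp: I.apath_def)
  have verts_eq: "I.awalk_verts = awalk_verts"
    by (rule compatible_awalk_verts[OF compatible_induce_subgraph])
  have w: "awalk (terminus \<Gamma> a) p (terminus \<Gamma> b)"
    by (rule subgraph_awalk_imp_awalk[OF p(1) subgraph_induce_subgraphI[OF D(1)]])
  have sub: "set (awalk_verts (terminus \<Gamma> a) p) \<subseteq> D"
    using p(1) unfolding I.awalk_conv verts_eq by simp
  have dist: "distinct (awalk_verts (terminus \<Gamma> a) p)" using p verts_eq by simp
  \<comment> \<open>Different arcs with a common origin have different termini, so the path is not
    empty. This brings the cycle to length at least three, beyond a mere walk back and forth along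
    one arc.\<close>
  have "p \<noteq> []" using w ne by (auto simp: awalk_simps)
  let ?c = "a # p @ [rev_arc \<Gamma> b]"
  note r = is_graph_revD[OF g b(1)]
  have "awalk (terminus \<Gamma> a) (p @ [rev_arc \<Gamma> b]) (origin \<Gamma> a)"
    using w r b(2) tail_in_verts[OF a(1)] by (auto simp: awalk_simps)
  moreover have "awalk_verts (terminus \<Gamma> a) (p @ [rev_arc \<Gamma> b]) = awalk_verts (terminus \<Gamma> a) p @ [origin \<Gamma> a]"
    using w r b(2) calculation by (auto simp: awalk_verts_append)
  ultimately have "cycle ?c"
    unfolding cycle_def using a dist sub by (intro exI[of _ "origin \<Gamma> a"]) (auto simp: awalk_simps)
  moreover have "3 \<le> length ?c" using \<open>p \<noteq> []\<close> by (cases p) auto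
  ultimately show False using \<Gamma> unfolding is_tree_def by blast
qed

text \<open>A path from outside \<open>D\<close> into \<open>D\<close> contains an arc that enters
  \<open>D\<close>. In the first tree it is the arc to extend along, in the second the arc that
  would witness a failure of surjectivity.\<close>

lemma strongly_connected_boundary:
  assumes \<Gamma>: "is_graph \<Gamma>" "strongly_connected (dg \<Gamma>)" and D: "D \<subset> vertices \<Gamma>" "D \<noteq> {}"
  obtains a where "a \<in> arrows \<Gamma>" "origin \<Gamma> a \<notin> D" "terminus \<Gamma> a \<in> D"
proof -
  obtain u v where uv: "u \<in> vertices \<Gamma>" "u \<notin> D" "v \<in> D" using D by auto
  then have "u \<rightarrow>\<^sup>*\<^bsub>dg \<Gamma>\<^esub> v" using \<Gamma>(2) D by (auto simp: strongly_connected_def)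
  then have "u \<notin> D \<longrightarrow> (\<exists>a \<in> arrows \<Gamma>. origin \<Gamma> a \<notin> D \<and> terminus \<Gamma> a \<in> D)"
  proof (induction rule: wf_digraph.converse_reachable_induct[OF is_graph_wf[OF \<Gamma>(1)], consumes 1, case_names base step])
    case base
    then show ?case using uv by simp
  next
    case (step x y)
    then show ?case by (auto simp: arcs_ends_conv)
  qed
  then show ?thesis using uv that by blast
qed

text \<open>The arc and its reverse join its origin to \<open>D\<close> in both directions.
  Connectedness of the domain is the invariant on which \<open>tree_unique_neighbour\<close>
  relies.\<close>

lemma strongly_connected_insert:
  assumes \<Gamma>: "is_graph \<Gamma>" and D: "strongly_connected (dg \<Gamma> \<restriction> D)"
    and a: "a \<in> arrows \<Gamma>" "terminus \<Gamma> a \<in> D"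
  shows "strongly_connected (dg \<Gamma> \<restriction> insert (origin \<Gamma> a) D)"
proof -
  let ?E = "insert (origin \<Gamma> a) D" and ?o = "origin \<Gamma> a" and ?t = "terminus \<Gamma> a"
  interpret I: wf_digraph "dg \<Gamma> \<restriction> ?E"
    by (rule wf_digraph.wellformed_induce_subgraph[OF is_graph_wf[OF \<Gamma>]])
  have D': "u \<rightarrow>\<^sup>*\<^bsub>dg \<Gamma> \<restriction> ?E\<^esub> v" if "u \<in> D" "v \<in> D" for u v
    by (rule reachable_induce_subgraph_mono[where D = D]) (use D that in \<open>auto simp: strongly_connected_def\<close>)
  have "?o \<rightarrow>\<^bsub>dg \<Gamma> \<restriction> ?E\<^esub> ?t"
    using a by (auto simp: arcs_ends_conv)
  moreover have "?t \<rightarrow>\<^bsub>dg \<Gamma> \<restriction> ?E\<^esub> ?o"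
    using a is_graph_revD[OF \<Gamma> a(1)] by (force simp: arcs_ends_conv)
  ultimately have o: "?o \<rightarrow>\<^sup>*\<^bsub>dg \<Gamma> \<restriction> ?E\<^esub> v \<and> v \<rightarrow>\<^sup>*\<^bsub>dg \<Gamma> \<restriction> ?E\<^esub> ?o" if "v \<in> D" for v
    using D'[OF a(2) that] D'[OF that a(2)] I.adj_reachable_trans I.reachable_adj_trans by blast
  then show ?thesis
    using D' by (auto simp: strongly_connected_def intro!: I.reachable_refl dest: o)
qed

section \<open>Adhesion sets and the action of the vertex groups\<close>

text \<open>The adhesion maps of an arc form one orbit under composition with the vertex group on
  the left, so a local map permutes the adhesion sets.\<close>

lemma adhesion_set_translate:
  assumes "is_gga \<G>" "a \<in> arrows (base \<G>)" "S \<in> adhesion_sets \<G> a"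
    and h: "h \<in> perms (vact \<G> (terminus (base \<G>) a))"
  shows "h ` S \<in> adhesion_sets \<G> a"
proof -
  let ?P = "vact \<G> (terminus (base \<G>) a)"
  have P: "perm_action ?P" by (rule gga_arcD(6)[OF assms(1,2)])
  obtain g where g: "g \<in> perms ?P" "S = compose (apts \<G> a) g (emb \<G> a) ` apts \<G> a"
    using assms(3) by (auto simp: adhesion_sets_def adhesion_maps_def)
  have "emb \<G> a y \<in> pts ?P" if "y \<in> apts \<G> a" for y
    using gga_arcD(7)[OF assms(1,2)] that by (auto simp: action_embedding_def)
  then have "h ` S = compose (apts \<G> a) (compose (pts ?P) h g) (emb \<G> a) ` apts \<G> a"
    using g(2) by (simp add: image_image compose_eq)
  then show ?thesis
    using perms_compose[OF P h g(1)] by (auto simp: adhesion_sets_def adhesion_maps_def)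
qed

text \<open>A twist only permutes the colours of the arc. Hence a twisted adhesion map is still
  injective, and its image is that of an untwisted one, an adhesion set.\<close>

lemma
  assumes \<G>: "is_gga \<G>" and a: "a \<in> arrows (base \<G>)" and \<psi>: "legal_pair \<G> a \<psi> \<psi>'"
  shows legal_pair_inj: "inj_on \<psi> (apts \<G> a)"
    and legal_pair_adhesion_set: "\<psi> ` apts \<G> a \<in> adhesion_sets \<G> a"
    and legal_pair_mem: "\<psi> ` apts \<G> a \<subseteq> vpts \<G> (terminus (base \<G>) a)"
proof -
  let ?P = "vact \<G> (terminus (base \<G>) a)" and ?Y = "apts \<G> a"
  obtain g u g' u' where g: "g \<in> perms ?P" "\<And>y. y \<in> ?Y \<Longrightarrow> \<psi> y = g (emb \<G> a (u y))"
    and u: "u = id \<or> self_reverse (base \<G>) a \<and> u = agent \<G> a"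
    by (rule legal_pairE[OF \<psi>]) (rule that, auto)
  have bu: "bij_betw u ?Y ?Y"
    using u inversion_agent_bij[OF gga_arcD(8)[OF \<G> a]] by auto
  have emb: "inj_on (emb \<G> a) ?Y" "emb \<G> a ` ?Y \<subseteq> pts ?P"
    using gga_arcD(7)[OF \<G> a] by (auto simp: action_embedding_def)
  have bg: "bij_betw g (pts ?P) (pts ?P)"
    by (rule perms_bij[OF gga_arcD(6)[OF \<G> a] g(1)])
  have "inj_on (g \<circ> (emb \<G> a \<circ> u)) ?Y"
  proof (intro comp_inj_on)
    show "inj_on u ?Y" "inj_on (emb \<G> a) (u ` ?Y)"
      using bu emb by (simp_all add: bij_betw_def)
    have "(emb \<G> a \<circ> u) ` ?Y \<subseteq> pts ?P"
      using bu emb unfolding image_comp[symmetric] by (simp add: bij_betw_def)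
    then show "inj_on g ((emb \<G> a \<circ> u) ` ?Y)"
      using bg by (auto simp: bij_betw_def intro: inj_on_subset)
  qed
  then show "inj_on \<psi> ?Y"
    using g(2) by (auto simp: inj_on_def)
  have "\<psi> ` ?Y = g ` emb \<G> a ` u ` ?Y"
    using g(2) by (simp add: image_image)
  then have im: "\<psi> ` ?Y = g ` emb \<G> a ` ?Y"
    using bu by (simp add: bij_betw_def)
  also have "\<dots> = compose ?Y g (emb \<G> a) ` ?Y"
    by (simp add: image_image compose_eq)
  finally show "\<psi> ` ?Y \<in> adhesion_sets \<G> a"
    using g(1) by (auto simp: adhesion_sets_def adhesion_maps_def)
  show "\<psi> ` ?Y \<subseteq> pts ?P"
    unfolding im using emb bg by (auto simp: bij_betw_def)
qed

section \<open>Scaffoldings\<close>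

locale scaffolding =
  fixes \<G> :: "('dv, 'da, 'g, 'x, 'h, 'y) gga"
    and \<Sigma> :: "('v, 'a, 'dv, 'da, 'x, 'y) scaf"
  assumes gga: "is_gga \<G>" and scaf: "is_scaffolding \<G> \<Sigma>"
begin

lemma graph: "is_graph (gr \<Sigma>)"
  and sim_equiv: "equiv (vertices (gr \<Sigma>)) (sim \<Sigma>)"
  and quot_tree: "is_tree (quot \<Sigma>)"
  and pi_morphism: "graph_morphism (quot \<Sigma>) (base \<G>) (piV \<Sigma>) (piA \<Sigma>)"
  and colouring: "legal_colouring \<G> \<Sigma>"
  using scaf by (auto simp: is_scaffolding_def)

lemma quot_graph: "is_graph (quot \<Sigma>)"
  using quot_tree by (simp add: is_tree_def)

lemma quot_connected: "strongly_connected (dg (quot \<Sigma>))"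
  using quot_tree is_graph_connected by (auto simp: is_tree_def)

lemmas quot_revD = is_graph_revD[OF quot_graph]
lemmas arc_equiv = equiv_arc_sim[OF graph sim_equiv]

lemma vertices_quot: "vertices (quot \<Sigma>) = vertices (gr \<Sigma>) // sim \<Sigma>"
  and arrows_quot: "arrows (quot \<Sigma>) = arrows (gr \<Sigma>) // arc_sim \<Sigma>"
  by (simp_all add: quot_def)

lemma arc_endsD:
  assumes "A \<in> arrows (quot \<Sigma>)"
  shows "origin (quot \<Sigma>) A \<in> vertices (quot \<Sigma>)" "terminus (quot \<Sigma>) A \<in> vertices (quot \<Sigma>)"
  using quot_graph assms by (auto simp: is_graph_def wf_digraph_def)

lemma pi_arcD:
  assumes "A \<in> arrows (quot \<Sigma>)"
  shows "piA \<Sigma> A \<in> arrows (base \<G>)"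
    and "origin (base \<G>) (piA \<Sigma> A) = piV \<Sigma> (origin (quot \<Sigma>) A)"
    and "terminus (base \<G>) (piA \<Sigma> A) = piV \<Sigma> (terminus (quot \<Sigma>) A)"
    and "piA \<Sigma> (rev_arc (quot \<Sigma>) A) = rev_arc (base \<G>) (piA \<Sigma> A)"
  using pi_morphism assms by (auto simp: graph_morphism_def)

lemma pi_vertex: "V \<in> vertices (quot \<Sigma>) \<Longrightarrow> piV \<Sigma> V \<in> vertices (base \<G>)"
  using pi_morphism by (auto simp: graph_morphism_def)

lemma pi_vertex_action: "V \<in> vertices (quot \<Sigma>) \<Longrightarrow> perm_action (vact \<G> (piV \<Sigma> V))"
  using gga pi_vertex by (simp add: is_gga_def)

lemma vertex_bundleD:
  assumes "V \<in> vertices (quot \<Sigma>)" "x \<in> V"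
  shows "x \<in> vertices (gr \<Sigma>)" "vbundle \<Sigma> x = V"
proof -
  obtain y where y: "V = vbundle \<Sigma> y"
    using assms(1) unfolding vertices_quot by (rule quotientE)
  then have "(y, x) \<in> sim \<Sigma>" using assms(2) by simp
  then show "x \<in> vertices (gr \<Sigma>)" "vbundle \<Sigma> x = V"
    using equiv_class_eq[OF sim_equiv] equiv_class_eq_iff[OF sim_equiv, of y x] y by auto
qed

lemma vertex_bundleI:
  assumes "x \<in> vertices (gr \<Sigma>)"
  shows "vbundle \<Sigma> x \<in> vertices (quot \<Sigma>)" "x \<in> vbundle \<Sigma> x"
  using assms
  by (simp_all add: vertices_quot quotientI equiv_class_self[OF sim_equiv] del: Image_singleton_iff)

lemma vertex_bundle_nonempty: "V \<in> vertices (quot \<Sigma>) \<Longrightarrow> V \<noteq> {}"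
  using in_quotient_imp_non_empty[OF sim_equiv] by (auto simp: vertices_quot)

lemma arc_bundleI:
  assumes "a \<in> arrows (gr \<Sigma>)"
  shows "abundle \<Sigma> a \<in> arrows (quot \<Sigma>)" "a \<in> abundle \<Sigma> a"
  using assms
  by (simp_all add: arrows_quot quotientI equiv_class_self[OF arc_equiv] del: Image_singleton_iff)

lemma arc_bundle_nonempty: "A \<in> arrows (quot \<Sigma>) \<Longrightarrow> A \<noteq> {}"
  using in_quotient_imp_non_empty[OF arc_equiv] by (auto simp: arrows_quot)

lemma arc_bundleD:
  assumes "A \<in> arrows (quot \<Sigma>)" "b \<in> A"
  shows "b \<in> arrows (gr \<Sigma>)" "abundle \<Sigma> b = A"
    and "origin (gr \<Sigma>) b \<in> origin (quot \<Sigma>) A" "terminus (gr \<Sigma>) b \<in> terminus (quot \<Sigma>) A"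
    and "rev_arc (gr \<Sigma>) b \<in> rev_arc (quot \<Sigma>) A"
proof -
  obtain a where a: "A = abundle \<Sigma> a"
    using assms(1) unfolding arrows_quot by (rule quotientE)
  then have ab: "(a, b) \<in> arc_sim \<Sigma>" using assms(2) by simp
  then show b: "b \<in> arrows (gr \<Sigma>)" by (simp add: arc_sim_def)
  show A: "abundle \<Sigma> b = A"
    using equiv_class_eq[OF arc_equiv ab] a by simp
  have "origin (gr \<Sigma>) b \<in> vertices (gr \<Sigma>)" "terminus (gr \<Sigma>) b \<in> vertices (gr \<Sigma>)"
    using graph b by (auto simp: is_graph_def wf_digraph_def)
  then show "origin (gr \<Sigma>) b \<in> origin (quot \<Sigma>) A" "terminus (gr \<Sigma>) b \<in> terminus (quot \<Sigma>) A"
    using quot_abundle(1,2)[OF graph sim_equiv b] vertex_bundleI(2) A by auto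
  show "rev_arc (gr \<Sigma>) b \<in> rev_arc (quot \<Sigma>) A"
    using quot_abundle(3)[OF graph sim_equiv b] is_graph_revD(1)[OF graph b] arc_bundleI(2) A by auto
qed

lemma no_loop: "A \<in> arrows (quot \<Sigma>) \<Longrightarrow> origin (quot \<Sigma>) A \<noteq> terminus (quot \<Sigma>) A"
  using quot_tree by (auto simp: is_tree_def loopfree_digraph_def loopfree_digraph_axioms_def)

section \<open>Colours and the maps of arc bundles\<close>

lemma colV_bij: "V \<in> vertices (quot \<Sigma>) \<Longrightarrow> bij_betw (colV \<Sigma>) V (vpts \<G> (piV \<Sigma> V))"
  and colA_bij: "A \<in> arrows (quot \<Sigma>) \<Longrightarrow> bij_betw (colA \<Sigma>) A (apts \<G> (piA \<Sigma> A))"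
  and colA_rev: "b \<in> arrows (gr \<Sigma>) \<Longrightarrow> colA \<Sigma> (rev_arc (gr \<Sigma>) b) = colA \<Sigma> b"
  using colouring by (auto simp: legal_colouring_def)

lemma apts_rev: "A \<in> arrows (quot \<Sigma>) \<Longrightarrow> apts \<G> (piA \<Sigma> (rev_arc (quot \<Sigma>) A)) = apts \<G> (piA \<Sigma> A)"
  using gga_arcD(4)[OF gga] pi_arcD by simp

lemma bundle_map_col:
  assumes "A \<in> arrows (quot \<Sigma>)" "b \<in> A"
  shows "bundle_map \<G> \<Sigma> A (colA \<Sigma> b) = colV \<Sigma> (terminus (gr \<Sigma>) b)"
  using bundle_map_unique[OF colA_bij[OF assms(1)], of "bundle_map \<G> \<Sigma> A"] assms(2)
  by (simp add: bundle_map_def)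

text \<open>Reversal preserves colours and exchanges ends, so one colour addresses an arc in its
  bundle and its reverse in the reversed bundle.\<close>

lemma bundle_map_rev_col:
  assumes "A \<in> arrows (quot \<Sigma>)" "b \<in> A"
  shows "bundle_map \<G> \<Sigma> (rev_arc (quot \<Sigma>) A) (colA \<Sigma> b) = colV \<Sigma> (origin (gr \<Sigma>) b)"
proof -
  have "b \<in> arrows (gr \<Sigma>)" "rev_arc (gr \<Sigma>) b \<in> rev_arc (quot \<Sigma>) A"
    using arc_bundleD assms by auto
  then show ?thesis
    using bundle_map_col[OF quot_revD(1)[OF assms(1)], of "rev_arc (gr \<Sigma>) b"]
    by (simp add: colA_rev is_graph_revD[OF graph])
qed

text \<open>The clause of the legal colouring is applied to the bundle and to its reverse; either
  both lie over self-reverse arcs or neither does.\<close>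

lemma bundle_map_legal:
  assumes "A \<in> arrows (quot \<Sigma>)"
  shows "legal_pair \<G> (piA \<Sigma> A) (bundle_map \<G> \<Sigma> A) (bundle_map \<G> \<Sigma> (rev_arc (quot \<Sigma>) A))"
proof -
  have legal: "if self_reverse (base \<G>) (piA \<Sigma> B)
      then (bundle_map \<G> \<Sigma> B \<in> adhesion_maps \<G> (piA \<Sigma> B) \<and>
          bundle_map \<G> \<Sigma> (rev_arc (quot \<Sigma>) B) \<in> twisted_adhesion_maps \<G> (piA \<Sigma> B)) \<or>
        (bundle_map \<G> \<Sigma> (rev_arc (quot \<Sigma>) B) \<in> adhesion_maps \<G> (piA \<Sigma> B) \<and>
          bundle_map \<G> \<Sigma> B \<in> twisted_adhesion_maps \<G> (piA \<Sigma> B))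
      else bundle_map \<G> \<Sigma> B \<in> adhesion_maps \<G> (piA \<Sigma> B)"
    if "B \<in> arrows (quot \<Sigma>)" for B
    using colouring that unfolding legal_colouring_def Let_def by blast
  have "self_reverse (base \<G>) (rev_arc (base \<G>) (piA \<Sigma> A)) \<longleftrightarrow> self_reverse (base \<G>) (piA \<Sigma> A)"
    using gga_arcD(2)[OF gga pi_arcD(1)[OF assms]] by (auto simp: self_reverse_def)
  then show ?thesis
    using legal[OF assms] legal[OF quot_revD(1)[OF assms]] pi_arcD(4)[OF assms]
    by (auto simp: legal_pair_def split: if_splits)
qed

lemma bundle_map_inj: "A \<in> arrows (quot \<Sigma>) \<Longrightarrow> inj_on (bundle_map \<G> \<Sigma> A) (apts \<G> (piA \<Sigma> A))"
  and bundle_map_adhesion_set: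
    "A \<in> arrows (quot \<Sigma>) \<Longrightarrow> bundle_map \<G> \<Sigma> A ` apts \<G> (piA \<Sigma> A) \<in> adhesion_sets \<G> (piA \<Sigma> A)"
  and bundle_map_mem: "A \<in> arrows (quot \<Sigma>) \<Longrightarrow>
    bundle_map \<G> \<Sigma> A ` apts \<G> (piA \<Sigma> A) \<subseteq> vpts \<G> (piV \<Sigma> (terminus (quot \<Sigma>) A))"
  using legal_pair_inj[OF gga _ bundle_map_legal] legal_pair_adhesion_set[OF gga _ bundle_map_legal]
    legal_pair_mem[OF gga _ bundle_map_legal] pi_arcD by auto

lemma adhesion_arc_ex1:
  assumes "V \<in> vertices (quot \<Sigma>)" "b \<in> arrows (base \<G>)" "terminus (base \<G>) b = piV \<Sigma> V"
    "S \<in> adhesion_sets \<G> b"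
  shows "\<exists>!A. A \<in> arrows (quot \<Sigma>) \<and> terminus (quot \<Sigma>) A = V \<and> piA \<Sigma> A = b \<and>
    bundle_map \<G> \<Sigma> A ` apts \<G> b = S"
proof -
  have "\<forall>V \<in> vertices (quot \<Sigma>). \<forall>b \<in> arrows (base \<G>). terminus (base \<G>) b = piV \<Sigma> V \<longrightarrow>
      (\<forall>S \<in> adhesion_sets \<G> b. \<exists>!A. A \<in> arrows (quot \<Sigma>) \<and> terminus (quot \<Sigma>) A = V \<and>
        piA \<Sigma> A = b \<and> bundle_map \<G> \<Sigma> A ` apts \<G> b = S)"
    using colouring unfolding legal_colouring_def by (elim conjE)
  from this[rule_format, OF assms] show ?thesis .
qed

lemma adhesion_arc_unique:
  assumes "A \<in> arrows (quot \<Sigma>)" "B \<in> arrows (quot \<Sigma>)"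
    "terminus (quot \<Sigma>) A = terminus (quot \<Sigma>) B" "piA \<Sigma> A = piA \<Sigma> B"
    "bundle_map \<G> \<Sigma> A ` apts \<G> (piA \<Sigma> A) = bundle_map \<G> \<Sigma> B ` apts \<G> (piA \<Sigma> A)"
  shows "A = B"
  by (rule ex1E[OF adhesion_arc_ex1[OF arc_endsD(2)[OF assms(1)] pi_arcD(1,3)[OF assms(1)]
      bundle_map_adhesion_set[OF assms(1)]]]) (use assms in metis)

text \<open>Arcs with equal ends lie in one bundle. There the terminus has a colour from which the
  injective \<Psi> recovers the colour of the arc, and this singles out the arc. Consequently the
  vertex part of a morphism determines its arc part.\<close>

lemma arc_eqI:
  assumes a: "a \<in> arrows (gr \<Sigma>)" and b: "b \<in> arrows (gr \<Sigma>)"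
    and o: "origin (gr \<Sigma>) a = origin (gr \<Sigma>) b" and t: "terminus (gr \<Sigma>) a = terminus (gr \<Sigma>) b"
  shows "a = b"
proof -
  let ?A = "abundle \<Sigma> a"
  have A: "?A \<in> arrows (quot \<Sigma>)" "a \<in> ?A" using arc_bundleI[OF a] by auto
  have "(origin (gr \<Sigma>) a, origin (gr \<Sigma>) a) \<in> sim \<Sigma>" "(terminus (gr \<Sigma>) a, terminus (gr \<Sigma>) a) \<in> sim \<Sigma>"
    using A(2) by (auto simp: arc_sim_def)
  then have B: "b \<in> ?A" using a b o t by (simp add: arc_sim_def)
  have "bundle_map \<G> \<Sigma> ?A (colA \<Sigma> a) = bundle_map \<G> \<Sigma> ?A (colA \<Sigma> b)"
    using bundle_map_col[OF A] bundle_map_col[OF A(1) B] t by simp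
  then show ?thesis
    using bundle_map_inj[OF A(1)] colA_bij[OF A(1)] A(2) B
    by (metis bij_betw_def imageI inj_onD)
qed

end

section \<open>Matchings of two scaffoldings\<close>

locale scaffolding_pair = S: scaffolding \<G> \<Sigma> + S': scaffolding \<G> \<Sigma>'
  for \<G> :: "('dv, 'da, 'g, 'x, 'h, 'y) gga"
    and \<Sigma> :: "('v, 'a, 'dv, 'da, 'x, 'y) scaf"
    and \<Sigma>' :: "('w, 'b, 'dv, 'da, 'x, 'y) scaf"
begin

text \<open>The arguments \<open>g\<close> and \<open>h\<close> are the local maps at origin and
  terminus. Inside \<open>colour_compatible\<close> the terminus comes before the origin, because
  \<Psi> belongs to the terminus of its bundle.\<close>

definition arc_match :: "'a set \<Rightarrow> 'b set \<Rightarrow> ('x \<Rightarrow> 'x) \<Rightarrow> ('x \<Rightarrow> 'x) \<Rightarrow> bool" where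
  "arc_match A A' g h \<longleftrightarrow> piA \<Sigma> A = piA \<Sigma>' A' \<and>
     colour_compatible (apts \<G> (piA \<Sigma> A)) (bundle_map \<G> \<Sigma> A) (bundle_map \<G> \<Sigma>' A') h
       (bundle_map \<G> \<Sigma> (rev_arc (quot \<Sigma>) A)) (bundle_map \<G> \<Sigma>' (rev_arc (quot \<Sigma>') A')) g"

text \<open>The first clause makes a set of pairwise fitting triples the graph of an injective
  function with one local map per bundle. The arc clauses go in both directions: the backward one
  keeps a new image bundle from being already taken, and later yields surjectivity on arcs.\<close>

definition fits :: "'v set \<times> 'w set \<times> ('x \<Rightarrow> 'x) \<Rightarrow> 'v set \<times> 'w set \<times> ('x \<Rightarrow> 'x) \<Rightarrow> bool" where
  "fits = (\<lambda>(V, V', g) (W, W', h).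
     (V = W \<or> V' = W' \<longrightarrow> V = W \<and> V' = W' \<and> g = h) \<and>
     (\<forall>A \<in> arrows (quot \<Sigma>). origin (quot \<Sigma>) A = V \<and> terminus (quot \<Sigma>) A = W \<longrightarrow>
        (\<exists>A' \<in> arrows (quot \<Sigma>'). origin (quot \<Sigma>') A' = V' \<and> terminus (quot \<Sigma>') A' = W' \<and>
           arc_match A A' g h)) \<and>
     (\<forall>A' \<in> arrows (quot \<Sigma>'). origin (quot \<Sigma>') A' = V' \<and> terminus (quot \<Sigma>') A' = W' \<longrightarrow>
        (\<exists>A \<in> arrows (quot \<Sigma>). origin (quot \<Sigma>) A = V \<and> terminus (quot \<Sigma>) A = W \<and>
           arc_match A A' g h)))"

definition local_iso :: "'v set \<times> 'w set \<times> ('x \<Rightarrow> 'x) \<Rightarrow> bool" where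
  "local_iso = (\<lambda>(V, V', g). V \<in> vertices (quot \<Sigma>) \<and> V' \<in> vertices (quot \<Sigma>') \<and>
     piV \<Sigma> V = piV \<Sigma>' V' \<and> g \<in> perms (vact \<G> (piV \<Sigma> V)))"

text \<open>
  A partial isomorphism of scaffoldings, encoded by the triples of a vertex bundle, its image and
  the local map between them.
\<close>

definition matching :: "('v set \<times> 'w set \<times> ('x \<Rightarrow> 'x)) set \<Rightarrow> bool" where
  "matching R \<longleftrightarrow> (\<forall>r \<in> R. local_iso r) \<and> (\<forall>r \<in> R. \<forall>s \<in> R. fits r s) \<and>
     strongly_connected (dg (quot \<Sigma>) \<restriction> fst ` R)"

lemma arc_match_rev:
  assumes "A \<in> arrows (quot \<Sigma>)" "A' \<in> arrows (quot \<Sigma>')" "arc_match A A' g h"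
  shows "arc_match (rev_arc (quot \<Sigma>) A) (rev_arc (quot \<Sigma>') A') h g"
proof -
  have "piA \<Sigma> (rev_arc (quot \<Sigma>) A) = piA \<Sigma>' (rev_arc (quot \<Sigma>') A')"
    using assms S.pi_arcD(4) S'.pi_arcD(4) by (simp add: arc_match_def)
  then show ?thesis
    using assms(3) unfolding arc_match_def S.apts_rev[OF assms(1)] S.quot_revD(2)[OF assms(1)]
      S'.quot_revD(2)[OF assms(2)] by (blast intro: colour_compatible_swap)
qed

text \<open>Reversing arcs exchanges the two triples, and \<open>arc_match\<close> is invariant
  under simultaneous reversal. So a new triple is tested against the old ones in one order
  only.\<close>

lemma fits_sym:
  assumes "fits r s"
  shows "fits s r"
proof -
  obtain V V' g where r: "r = (V, V', g)" by (cases r)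
  obtain W W' h where s: "s = (W, W', h)" by (cases s)
  show ?thesis
    unfolding r s fits_def split_conv
  proof (intro conjI ballI impI; (elim conjE)?)
    fix A assume A: "A \<in> arrows (quot \<Sigma>)" "origin (quot \<Sigma>) A = W" "terminus (quot \<Sigma>) A = V"
    note rA = S.quot_revD[OF A(1)]
    then obtain A' where A': "A' \<in> arrows (quot \<Sigma>')" "origin (quot \<Sigma>') A' = V'"
      "terminus (quot \<Sigma>') A' = W'" "arc_match (rev_arc (quot \<Sigma>) A) A' g h"
      using assms A unfolding r s fits_def split_conv by metis
    then show "\<exists>A' \<in> arrows (quot \<Sigma>'). origin (quot \<Sigma>') A' = W' \<and> terminus (quot \<Sigma>') A' = V' \<and>
        arc_match A A' h g"
      using arc_match_rev[OF rA(1) A'(1,4)] rA S'.quot_revD[OF A'(1)] by auto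
  next
    fix A' assume A': "A' \<in> arrows (quot \<Sigma>')" "origin (quot \<Sigma>') A' = W'" "terminus (quot \<Sigma>') A' = V'"
    note rA = S'.quot_revD[OF A'(1)]
    then obtain A where A: "A \<in> arrows (quot \<Sigma>)" "origin (quot \<Sigma>) A = V"
      "terminus (quot \<Sigma>) A = W" "arc_match A (rev_arc (quot \<Sigma>') A') g h"
      using assms A' unfolding r s fits_def split_conv by metis
    then show "\<exists>A \<in> arrows (quot \<Sigma>). origin (quot \<Sigma>) A = W \<and> terminus (quot \<Sigma>) A = V \<and>
        arc_match A A' h g"
      using arc_match_rev[OF A(1) rA(1) A(4)] rA S.quot_revD[OF A(1)] by auto
  qed (use assms in \<open>auto simp: r s fits_def\<close>)
qed

lemma arc_match_image:
  assumes "arc_match A A' g h"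
  shows "h ` bundle_map \<G> \<Sigma> A ` apts \<G> (piA \<Sigma> A) = bundle_map \<G> \<Sigma>' A' ` apts \<G> (piA \<Sigma> A)"
  using assms colour_compatible_image unfolding arc_match_def by blast

lemma matchingD:
  assumes "matching R" "(V, V', g) \<in> R"
  shows "V \<in> vertices (quot \<Sigma>)" "V' \<in> vertices (quot \<Sigma>')" "piV \<Sigma> V = piV \<Sigma>' V'"
    "g \<in> perms (vact \<G> (piV \<Sigma> V))"
  using assms by (auto simp: matching_def local_iso_def)

lemma matching_pairD:
  assumes "matching R" "(V, V', g) \<in> R" "(W, W', h) \<in> R"
  shows "V = W \<longleftrightarrow> V' = W'" "V = W \<Longrightarrow> g = h"
    and "\<lbrakk>A \<in> arrows (quot \<Sigma>); origin (quot \<Sigma>) A = V; terminus (quot \<Sigma>) A = W\<rbrakk> \<Longrightarrow>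
      \<exists>A' \<in> arrows (quot \<Sigma>'). origin (quot \<Sigma>') A' = V' \<and> terminus (quot \<Sigma>') A' = W' \<and> arc_match A A' g h"
    and "\<lbrakk>A' \<in> arrows (quot \<Sigma>'); origin (quot \<Sigma>') A' = V'; terminus (quot \<Sigma>') A' = W'\<rbrakk> \<Longrightarrow>
      \<exists>A \<in> arrows (quot \<Sigma>). origin (quot \<Sigma>) A = V \<and> terminus (quot \<Sigma>) A = W \<and> arc_match A A' g h"
proof -
  have f: "fits (V, V', g) (W, W', h)" using assms by (auto simp: matching_def)
  show "V = W \<longleftrightarrow> V' = W'" "V = W \<Longrightarrow> g = h" using f by (auto simp: fits_def)
  show "\<lbrakk>A \<in> arrows (quot \<Sigma>); origin (quot \<Sigma>) A = V; terminus (quot \<Sigma>) A = W\<rbrakk> \<Longrightarrow>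
      \<exists>A' \<in> arrows (quot \<Sigma>'). origin (quot \<Sigma>') A' = V' \<and> terminus (quot \<Sigma>') A' = W' \<and> arc_match A A' g h"
    using f unfolding fits_def split_conv by blast
  show "\<lbrakk>A' \<in> arrows (quot \<Sigma>'); origin (quot \<Sigma>') A' = V'; terminus (quot \<Sigma>') A' = W'\<rbrakk> \<Longrightarrow>
      \<exists>A \<in> arrows (quot \<Sigma>). origin (quot \<Sigma>) A = V \<and> terminus (quot \<Sigma>) A = W \<and> arc_match A A' g h"
    using f unfolding fits_def split_conv by blast
qed

text \<open>Adjacent bundles have adjacent images, so paths are carried to paths. Connectedness of
  the image allows \<open>tree_unique_neighbour\<close> to be applied in the second tree as
  well.\<close>

lemma matching_codomain_connected:
  assumes R: "matching R"
  shows "strongly_connected (dg (quot \<Sigma>') \<restriction> (fst \<circ> snd) ` R)"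
proof -
  define \<phi> where "\<phi> V = (SOME V'. \<exists>g. (V, V', g) \<in> R)" for V
  have \<phi>: "\<phi> V = V'" if "(V, V', g) \<in> R" for V V' g
    unfolding \<phi>_def by (rule some_equality) (use that matching_pairD(1)[OF R that] in auto)
  have wf: "wf_digraph (dg (quot \<Sigma>) \<restriction> D)" "wf_digraph (dg (quot \<Sigma>') \<restriction> D')" for D D'
    using wf_digraph.wellformed_induce_subgraph is_graph_wf S.quot_graph S'.quot_graph by blast+
  have "\<phi> V \<rightarrow>\<^sup>*\<^bsub>dg (quot \<Sigma>') \<restriction> (fst \<circ> snd) ` R\<^esub> \<phi> W"
    if "V \<in> fst ` R" "W \<in> fst ` R" for V W
  proof (rule reachable_image[OF wf])
    show "V \<rightarrow>\<^sup>*\<^bsub>dg (quot \<Sigma>) \<restriction> fst ` R\<^esub> W"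
      using R that unfolding matching_def strongly_connected_def induce_subgraph_verts by blast
    show "\<phi> v \<in> verts (dg (quot \<Sigma>') \<restriction> (fst \<circ> snd) ` R)"
      if "v \<in> verts (dg (quot \<Sigma>) \<restriction> fst ` R)" for v
      using that \<phi> by force
    show "(\<phi> u, \<phi> v) \<in> arcs_ends (dg (quot \<Sigma>') \<restriction> (fst \<circ> snd) ` R)"
      if uv: "(u, v) \<in> arcs_ends (dg (quot \<Sigma>) \<restriction> fst ` R)" for u v
    proof -
      obtain A where A: "A \<in> arrows (quot \<Sigma>)" "origin (quot \<Sigma>) A = u" "terminus (quot \<Sigma>) A = v"
        "u \<in> fst ` R" "v \<in> fst ` R"
        using uv by (auto simp: arcs_ends_conv)
      then obtain u' g v' h where R2: "(u, u', g) \<in> R" "(v, v', h) \<in> R" by force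
      from matching_pairD(3)[OF R this A(1-3)] obtain A' where
        A': "A' \<in> arrows (quot \<Sigma>')" "origin (quot \<Sigma>') A' = u'" "terminus (quot \<Sigma>') A' = v'"
        by blast
      have "u' \<in> (fst \<circ> snd) ` R" "v' \<in> (fst \<circ> snd) ` R"
        using R2 by force+
      then show ?thesis
        using A' \<phi>[OF R2(1)] \<phi>[OF R2(2)] by (auto simp: arcs_ends_conv)
    qed
  qed
  moreover have "(fst \<circ> snd) ` R = \<phi> ` fst ` R"
    using \<phi> by (force simp: image_image)
  moreover have "fst ` R \<noteq> {}"
    using R by (simp add: matching_def strongly_connected_def)
  ultimately show ?thesis by (auto simp: strongly_connected_def)
qed

section \<open>Extension by one vertex bundle\<close>

lemma matching_arc_lift:
  assumes R: "matching R" and W: "(W, W', h) \<in> R"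
    and A: "A \<in> arrows (quot \<Sigma>)" "terminus (quot \<Sigma>) A = W" "origin (quot \<Sigma>) A \<notin> fst ` R"
  obtains V' g A' where "local_iso (origin (quot \<Sigma>) A, V', g)" "V' \<notin> (fst \<circ> snd) ` R"
    "A' \<in> arrows (quot \<Sigma>')" "origin (quot \<Sigma>') A' = V'" "terminus (quot \<Sigma>') A' = W'"
    "arc_match A A' g h"
proof -
  let ?a = "piA \<Sigma> A"
  note WD = matchingD[OF R W]
  note a = S.pi_arcD[OF A(1)]
  have h: "h \<in> perms (vact \<G> (terminus (base \<G>) ?a))" using WD a A by simp
  have "h ` bundle_map \<G> \<Sigma> A ` apts \<G> ?a \<in> adhesion_sets \<G> ?a"
    by (rule adhesion_set_translate[OF S.gga a(1) S.bundle_map_adhesion_set[OF A(1)] h])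
  then obtain A' where A': "A' \<in> arrows (quot \<Sigma>')" "terminus (quot \<Sigma>') A' = W'" "piA \<Sigma>' A' = ?a"
    "bundle_map \<G> \<Sigma>' A' ` apts \<G> ?a = h ` bundle_map \<G> \<Sigma> A ` apts \<G> ?a"
    using ex1_implies_ex[OF S'.adhesion_arc_ex1[OF WD(2) a(1)]] a(3) A(2) WD(3) by metis
  obtain g where g: "g \<in> perms (vact \<G> (origin (base \<G>) ?a))" "arc_match A A' g h"
    using legal_pair_extend[OF S.gga a(1) S.bundle_map_legal[OF A(1)]
        S'.bundle_map_legal[OF A'(1), unfolded A'(3)] h A'(4)[symmetric]] A'(3)
    by (auto simp: arc_match_def)
  show ?thesis
  proof (rule that[OF _ _ A'(1) refl A'(2) g(2)])
    show "local_iso (origin (quot \<Sigma>) A, origin (quot \<Sigma>') A', g)"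
      using S.arc_endsD[OF A(1)] S'.arc_endsD[OF A'(1)] g(1) a(2) S'.pi_arcD(2)[OF A'(1)] A'(3)
      by (simp add: local_iso_def)
    \<comment> \<open>If the image bundle were already taken, the backward arc clause would give an
      arc \<open>B\<close> at \<open>W\<close> matched with \<open>A'\<close>. Then \<open>h\<close>
      maps the adhesion sets of \<open>A\<close> and \<open>B\<close> to the same set, so they
      coincide, and \<open>A = B\<close> by the uniqueness in the colouring, although the origin of
      \<open>A\<close> lies outside the domain.\<close>
    show "origin (quot \<Sigma>') A' \<notin> (fst \<circ> snd) ` R"
    proof
      assume "origin (quot \<Sigma>') A' \<in> (fst \<circ> snd) ` R"
      then obtain U U' f where U: "(U, U', f) \<in> R" "origin (quot \<Sigma>') A' = U'" by force
      obtain B where B: "B \<in> arrows (quot \<Sigma>)" "origin (quot \<Sigma>) B = U" "terminus (quot \<Sigma>) B = W"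
        "arc_match B A' f h"
        using matching_pairD(4)[OF R U(1) W A'(1) U(2) A'(2)] by blast
      have pi: "piA \<Sigma> B = ?a" using B(4) A'(3) by (simp add: arc_match_def)
      have "h ` bundle_map \<G> \<Sigma> B ` apts \<G> ?a = h ` bundle_map \<G> \<Sigma> A ` apts \<G> ?a"
        using arc_match_image[OF B(4)] pi A'(4) by simp
      moreover have "inj_on h (vpts \<G> (piV \<Sigma> W))"
        using perms_bij[OF S.pi_vertex_action[OF WD(1)] WD(4)] by (simp add: bij_betw_def)
      moreover have "bundle_map \<G> \<Sigma> B ` apts \<G> ?a \<subseteq> vpts \<G> (piV \<Sigma> W)"
        "bundle_map \<G> \<Sigma> A ` apts \<G> ?a \<subseteq> vpts \<G> (piV \<Sigma> W)"
        using S.bundle_map_mem[OF B(1)] S.bundle_map_mem[OF A(1)] B(3) A(2) pi by auto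
      ultimately have "bundle_map \<G> \<Sigma> B ` apts \<G> ?a = bundle_map \<G> \<Sigma> A ` apts \<G> ?a"
        by (simp add: inj_on_image_eq_iff)
      then have "B = A"
        using S.adhesion_arc_unique[OF B(1) A(1)] B(3) A(2) pi by simp
      then show False using A(3) B(2) U(1) by force
    qed
  qed
qed

text \<open>The tree property on both sides leaves one arc from the new bundle into the old ones, so
  the arc conditions reduce to the matched pair \<open>A\<close>, \<open>A'\<close>.\<close>

lemma matching_insert:
  assumes R: "matching R" and W: "(W, W', h) \<in> R"
    and A: "A \<in> arrows (quot \<Sigma>)" "terminus (quot \<Sigma>) A = W" "origin (quot \<Sigma>) A \<notin> fst ` R"
  shows "\<exists>V' g. matching (insert (origin (quot \<Sigma>) A, V', g) R)"
proof -
  let ?V = "origin (quot \<Sigma>) A"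
  obtain V' g A' where new: "local_iso (?V, V', g)" "V' \<notin> (fst \<circ> snd) ` R"
    and A': "A' \<in> arrows (quot \<Sigma>')" "origin (quot \<Sigma>') A' = V'" "terminus (quot \<Sigma>') A' = W'"
    and m: "arc_match A A' g h"
    by (rule matching_arc_lift[OF assms]) (rule that)
  have conn: "strongly_connected (dg (quot \<Sigma>) \<restriction> fst ` R)"
    using R by (simp add: matching_def)
  have sub: "fst ` R \<subseteq> vertices (quot \<Sigma>)" "(fst \<circ> snd) ` R \<subseteq> vertices (quot \<Sigma>')"
    using matchingD[OF R] by auto
  have mem: "W \<in> fst ` R" "W' \<in> (fst \<circ> snd) ` R" using W by force+
  have fit: "fits (?V, V', g) (U, U', f)" if U: "(U, U', f) \<in> R" for U U' f
  proof -
    have ne: "?V \<noteq> U" "V' \<noteq> U'" using U A(3) new(2) by force+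
    have memU: "U \<in> fst ` R" "U' \<in> (fst \<circ> snd) ` R" using U by force+
    show ?thesis
      unfolding fits_def split_conv
    proof (intro conjI ballI impI; (elim conjE)?)
      fix B assume B: "B \<in> arrows (quot \<Sigma>)" "origin (quot \<Sigma>) B = ?V" "terminus (quot \<Sigma>) B = U"
      have "A = B"
        using tree_unique_neighbour[OF S.quot_tree sub(1) conn A(1,3) _ B(1,2)] A(2) B(3) mem memU
        by simp
      then have "U = W" using A(2) B(3) by simp
      then have "U' = W'" "f = h" using matching_pairD(1,2)[OF R U W] by auto
      then show "\<exists>A' \<in> arrows (quot \<Sigma>'). origin (quot \<Sigma>') A' = V' \<and> terminus (quot \<Sigma>') A' = U' \<and>
          arc_match B A' g f"
        using \<open>A = B\<close> A' m by blast
    next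
      fix B assume B: "B \<in> arrows (quot \<Sigma>')" "origin (quot \<Sigma>') B = V'" "terminus (quot \<Sigma>') B = U'"
      have "A' = B"
        using tree_unique_neighbour[OF S'.quot_tree sub(2) matching_codomain_connected[OF R] A'(1) _ _ B(1)]
          A' B new(2) mem memU by simp
      then have "U' = W'" using A'(3) B(3) by simp
      then have "U = W" "f = h" using matching_pairD(1,2)[OF R U W] by auto
      then show "\<exists>A \<in> arrows (quot \<Sigma>). origin (quot \<Sigma>) A = ?V \<and> terminus (quot \<Sigma>) A = U \<and>
          arc_match A B g f"
        using \<open>A' = B\<close> A m by blast
    qed (use ne in auto)
  qed
  \<comment> \<open>Neither tree has loops, so the arc conditions between a triple and itself are
    vacuous.\<close>
  have self: "fits (?V, V', g) (?V, V', g)"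
    unfolding fits_def split_conv using S.no_loop S'.no_loop by metis
  have "matching (insert (?V, V', g) R)"
    unfolding matching_def
  proof (intro conjI)
    show "\<forall>r \<in> insert (?V, V', g) R. local_iso r"
      using new(1) R by (simp add: matching_def)
    have "fits (?V, V', g) r" if "r \<in> R" for r
      using fit that by (cases r) auto
    then show "\<forall>r \<in> insert (?V, V', g) R. \<forall>s \<in> insert (?V, V', g) R. fits r s"
      using self R fits_sym unfolding matching_def by blast
    show "strongly_connected (dg (quot \<Sigma>) \<restriction> fst ` insert (?V, V', g) R)"
      using strongly_connected_insert[OF S.quot_graph conn A(1)] A(2) mem by simp
  qed
  then show ?thesis by blast
qed

section \<open>Maximal matchings\<close>

text \<open>Every condition concerns at most two triples, or a path between two bundles, and any two
  triples of the union already lie in one member of the chain.\<close>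

lemma matching_chain_Union:
  assumes "C \<noteq> {}" "subset.chain {R. matching R} C"
  shows "matching (\<Union>C)"
proof -
  have C: "matching R" if "R \<in> C" for R
    using assms(2) that by (auto simp: subset.chain_def)
  have common: "\<exists>R \<in> C. r \<in> R \<and> s \<in> R" if rs: "r \<in> \<Union>C" "s \<in> \<Union>C" for r s
  proof -
    obtain X Y where XY: "X \<in> C" "r \<in> X" "Y \<in> C" "s \<in> Y" using rs by blast
    then have "X \<subseteq> Y \<or> Y \<subseteq> X" using assms(2) unfolding subset_chain_def by blast
    then show ?thesis using XY by blast
  qed
  show ?thesis
    unfolding matching_def
  proof (intro conjI ballI)
    show "local_iso r" if "r \<in> \<Union>C" for r
      using C that by (auto simp: matching_def)
    show "fits r s" if "r \<in> \<Union>C" "s \<in> \<Union>C" for r s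
      using common[OF that] C by (auto simp: matching_def)
    have "V \<rightarrow>\<^sup>*\<^bsub>dg (quot \<Sigma>) \<restriction> fst ` \<Union>C\<^esub> W" if VW: "V \<in> fst ` \<Union>C" "W \<in> fst ` \<Union>C" for V W
    proof -
      obtain r s where rs: "r \<in> \<Union>C" "V = fst r" "s \<in> \<Union>C" "W = fst s"
        using VW by blast
      then obtain R where R: "R \<in> C" "r \<in> R" "s \<in> R" using common by blast
      then have "V \<rightarrow>\<^sup>*\<^bsub>dg (quot \<Sigma>) \<restriction> fst ` R\<^esub> W"
        using C[OF R(1)] rs by (simp add: matching_def strongly_connected_def)
      then show ?thesis
        by (rule reachable_induce_subgraph_mono) (use R(1) in blast)
    qed
    moreover have "fst ` \<Union>C \<noteq> {}"
      using assms(1) C by (fastforce simp: matching_def strongly_connected_def)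
    ultimately show "strongly_connected (dg (quot \<Sigma>) \<restriction> fst ` \<Union>C)"
      by (simp add: strongly_connected_def)
  qed
qed

text \<open>A boundary arc \<open>A'\<close> of the image is pulled back: the inverse of
  \<open>h\<close> turns its adhesion set into one at \<open>W\<close>, realised by some arc
  \<open>A\<close>. As the domain is full, \<open>A\<close> has a partner \<open>B\<close> inside
  the image, and \<open>B\<close> has the adhesion set of \<open>A'\<close>. So
  \<open>B = A'\<close>, a contradiction.\<close>

lemma matching_codomain_full:
  assumes R: "matching R" and full: "fst ` R = vertices (quot \<Sigma>)"
  shows "(fst \<circ> snd) ` R = vertices (quot \<Sigma>')"
proof (rule ccontr)
  assume ne: "(fst \<circ> snd) ` R \<noteq> vertices (quot \<Sigma>')"
  have "(fst \<circ> snd) ` R \<subset> vertices (quot \<Sigma>')" "(fst \<circ> snd) ` R \<noteq> {}"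
    using ne matchingD[OF R] R by (auto simp: matching_def strongly_connected_def)
  then obtain A' where A': "A' \<in> arrows (quot \<Sigma>')" "origin (quot \<Sigma>') A' \<notin> (fst \<circ> snd) ` R"
    "terminus (quot \<Sigma>') A' \<in> (fst \<circ> snd) ` R"
    using strongly_connected_boundary[OF S'.quot_graph S'.quot_connected] by blast
  then obtain W W' h where W: "(W, W', h) \<in> R" "terminus (quot \<Sigma>') A' = W'" by force
  let ?a = "piA \<Sigma>' A'"
  note WD = matchingD[OF R W(1)]
  note a = S'.pi_arcD[OF A'(1)]
  have ta: "terminus (base \<G>) ?a = piV \<Sigma> W" using a W WD by simp
  have P: "perm_action (vact \<G> (piV \<Sigma> W))" by (rule S.pi_vertex_action[OF WD(1)])
  obtain h' where h': "h' \<in> perms (vact \<G> (piV \<Sigma> W))" "\<And>x. x \<in> vpts \<G> (piV \<Sigma> W) \<Longrightarrow> h (h' x) = x"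
    by (rule perms_inverse[OF P WD(4)]) (rule that)
  have "h' ` bundle_map \<G> \<Sigma>' A' ` apts \<G> ?a \<in> adhesion_sets \<G> ?a"
    using adhesion_set_translate[OF S.gga a(1) S'.bundle_map_adhesion_set[OF A'(1)]] h'(1) ta by simp
  then obtain A where A: "A \<in> arrows (quot \<Sigma>)" "terminus (quot \<Sigma>) A = W" "piA \<Sigma> A = ?a"
    "bundle_map \<G> \<Sigma> A ` apts \<G> ?a = h' ` bundle_map \<G> \<Sigma>' A' ` apts \<G> ?a"
    using ex1_implies_ex[OF S.adhesion_arc_ex1[OF WD(1) a(1) ta]] by metis
  have "origin (quot \<Sigma>) A \<in> fst ` R" using full S.arc_endsD[OF A(1)] by simp
  then obtain V V' g where V: "(V, V', g) \<in> R" "origin (quot \<Sigma>) A = V" by force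
  obtain B where B: "B \<in> arrows (quot \<Sigma>')" "origin (quot \<Sigma>') B = V'" "terminus (quot \<Sigma>') B = W'"
    "arc_match A B g h"
    using matching_pairD(3)[OF R V(1) W(1) A(1) V(2) A(2)] by blast
  have "bundle_map \<G> \<Sigma>' A' ` apts \<G> ?a \<subseteq> vpts \<G> (piV \<Sigma> W)"
    using S'.bundle_map_mem[OF A'(1)] W(2) WD(3) by simp
  then have "h ` h' ` bundle_map \<G> \<Sigma>' A' ` apts \<G> ?a = bundle_map \<G> \<Sigma>' A' ` apts \<G> ?a"
    using h'(2) by (force simp: image_image)
  then have "bundle_map \<G> \<Sigma>' B ` apts \<G> ?a = bundle_map \<G> \<Sigma>' A' ` apts \<G> ?a"
    using arc_match_image[OF B(4)] A(3,4) by simp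
  moreover have "piA \<Sigma>' B = ?a" using B(4) A(3) by (simp add: arc_match_def)
  ultimately have "B = A'"
    using S'.adhesion_arc_unique[OF B(1) A'(1)] B(3) W(2) by simp
  then show False using A'(2) B(2) V(1) by force
qed

lemma matching_total:
  assumes "matching R\<^sub>0"
  obtains R where "matching R" "R\<^sub>0 \<subseteq> R" "fst ` R = vertices (quot \<Sigma>)"
    "(fst \<circ> snd) ` R = vertices (quot \<Sigma>')"
proof -
  let ?\<A> = "{R. matching R \<and> R\<^sub>0 \<subseteq> R}"
  have "\<exists>M \<in> ?\<A>. \<forall>X \<in> ?\<A>. M \<subseteq> X \<longrightarrow> X = M"
  proof (rule subset_Zorn_nonempty)
    show "?\<A> \<noteq> {}" using assms by blast
    fix C assume C: "C \<noteq> {}" "subset.chain ?\<A> C"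
    then have "subset.chain {R. matching R} C" by (auto simp: subset.chain_def)
    then have "matching (\<Union>C)" by (rule matching_chain_Union[OF C(1)])
    moreover obtain X where "X \<in> C" using C(1) by blast
    moreover have "C \<subseteq> ?\<A>" using C(2) by (simp add: subset_chain_def)
    ultimately show "\<Union>C \<in> ?\<A>" by blast
  qed
  then obtain R where "R \<in> ?\<A>" and maximal: "\<forall>X \<in> ?\<A>. R \<subseteq> X \<longrightarrow> X = R"
    by (rule bexE)
  then have R: "matching R" "R\<^sub>0 \<subseteq> R" by simp_all
  have max: "X = R" if "matching X" "R \<subseteq> X" for X
    using maximal[rule_format, of X] that R(2) by simp
  \<comment> \<open>An incomplete domain has a boundary arc, along which the maximal matching would
    grow.\<close>
  have full: "fst ` R = vertices (quot \<Sigma>)"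
  proof (rule ccontr)
    assume "fst ` R \<noteq> vertices (quot \<Sigma>)"
    then have "fst ` R \<subset> vertices (quot \<Sigma>)" "fst ` R \<noteq> {}"
      using matchingD[OF R(1)] R(1) by (auto simp: matching_def strongly_connected_def)
    then obtain A where A: "A \<in> arrows (quot \<Sigma>)" "origin (quot \<Sigma>) A \<notin> fst ` R"
      "terminus (quot \<Sigma>) A \<in> fst ` R"
      using strongly_connected_boundary[OF S.quot_graph S.quot_connected] by blast
    then obtain W' h where "(terminus (quot \<Sigma>) A, W', h) \<in> R" by force
    then obtain V' g where "matching (insert (origin (quot \<Sigma>) A, V', g) R)"
      using matching_insert[OF R(1) _ A(1) refl A(2)] by blast
    then have "(origin (quot \<Sigma>) A, V', g) \<in> R" using max by blast
    then show False using A(2) by force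
  qed
  show ?thesis by (rule that[OF R full matching_codomain_full[OF R(1) full]])
qed

end

section \<open>Acceptable maps as matchings\<close>

lemma vertices_over: "vertices (over \<Sigma> S) = \<Union> (vertices S)"
  and arrows_over: "arrows (over \<Sigma> S) = {a \<in> arrows (gr \<Sigma>).
    origin (gr \<Sigma>) a \<in> \<Union> (vertices S) \<and> terminus (gr \<Sigma>) a \<in> \<Union> (vertices S)}"
  and ends_over: "origin (over \<Sigma> S) = origin (gr \<Sigma>)" "terminus (over \<Sigma> S) = terminus (gr \<Sigma>)"
  and rev_over: "rev_arc (over \<Sigma> S) = rev_arc (gr \<Sigma>)"
  by (simp_all add: over_def induced_rgraph_def)

lemmas over_simps = vertices_over arrows_over ends_over rev_over

context scaffolding
begin

lemma over_quot_simps: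
  "vertices (over \<Sigma> (quot \<Sigma>)) = vertices (gr \<Sigma>)" "arrows (over \<Sigma> (quot \<Sigma>)) = arrows (gr \<Sigma>)"
proof -
  show v: "vertices (over \<Sigma> (quot \<Sigma>)) = vertices (gr \<Sigma>)"
    using Union_quotient[OF sim_equiv] by (simp add: vertices_over vertices_quot)
  show "arrows (over \<Sigma> (quot \<Sigma>)) = arrows (gr \<Sigma>)"
    using v graph by (auto simp: arrows_over vertices_over is_graph_def wf_digraph_def)
qed

end

locale acceptable_partial_iso = scaffolding_pair \<G> \<Sigma> \<Sigma>'
  for \<G> :: "('dv, 'da, 'g, 'x, 'h, 'y) gga"
    and \<Sigma> :: "('v, 'a, 'dv, 'da, 'x, 'y) scaf"
    and \<Sigma>' :: "('w, 'b, 'dv, 'da, 'x, 'y) scaf" +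
  fixes S\<^sub>0 :: "('v set, 'a set) rgraph"
    and S\<^sub>0' :: "('w set, 'b set) rgraph"
    and fV :: "'v \<Rightarrow> 'w" and fA :: "'a \<Rightarrow> 'b"
  assumes subtree: "is_subtree S\<^sub>0 (quot \<Sigma>)"
    and subtree': "is_subtree S\<^sub>0' (quot \<Sigma>')"
    and iso: "partial_scaffolding_iso \<Sigma> S\<^sub>0 \<Sigma>' S\<^sub>0' fV fA"
    and accept: "acceptable \<G> \<Sigma> S\<^sub>0 \<Sigma>' fV"
begin

abbreviation "arcs_over \<equiv> {a \<in> arrows (gr \<Sigma>).
  origin (gr \<Sigma>) a \<in> \<Union> (vertices S\<^sub>0) \<and> terminus (gr \<Sigma>) a \<in> \<Union> (vertices S\<^sub>0)}"
abbreviation "arcs_over' \<equiv> {a \<in> arrows (gr \<Sigma>').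
  origin (gr \<Sigma>') a \<in> \<Union> (vertices S\<^sub>0') \<and> terminus (gr \<Sigma>') a \<in> \<Union> (vertices S\<^sub>0')}"

lemma S\<^sub>0_vertex: "V \<in> vertices S\<^sub>0 \<Longrightarrow> V \<in> vertices (quot \<Sigma>)"
  and S\<^sub>0'_vertex: "V' \<in> vertices S\<^sub>0' \<Longrightarrow> V' \<in> vertices (quot \<Sigma>')"
  using subtree subtree' subgraph_imp_subverts by (auto simp: is_subtree_def is_subgraph_def)

lemma fV_bij: "bij_betw fV (\<Union> (vertices S\<^sub>0)) (\<Union> (vertices S\<^sub>0'))"
  and fA_bij: "bij_betw fA arcs_over arcs_over'"
  and fA_ends: "a \<in> arcs_over \<Longrightarrow> origin (gr \<Sigma>') (fA a) = fV (origin (gr \<Sigma>) a)"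
    "a \<in> arcs_over \<Longrightarrow> terminus (gr \<Sigma>') (fA a) = fV (terminus (gr \<Sigma>) a)"
  and fV_sim: "\<lbrakk>x \<in> \<Union> (vertices S\<^sub>0); y \<in> \<Union> (vertices S\<^sub>0)\<rbrakk> \<Longrightarrow>
    (x, y) \<in> sim \<Sigma> \<longleftrightarrow> (fV x, fV y) \<in> sim \<Sigma>'"
  and fA_sim: "\<lbrakk>a \<in> arcs_over; b \<in> arcs_over\<rbrakk> \<Longrightarrow> (a, b) \<in> arc_sim \<Sigma> \<longleftrightarrow> (fA a, fA b) \<in> arc_sim \<Sigma>'"
  and fV_pi: "x \<in> \<Union> (vertices S\<^sub>0) \<Longrightarrow> piV \<Sigma> (vbundle \<Sigma> x) = piV \<Sigma>' (vbundle \<Sigma>' (fV x))"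
  and fA_pi: "a \<in> arcs_over \<Longrightarrow> piA \<Sigma> (abundle \<Sigma> a) = piA \<Sigma>' (abundle \<Sigma>' (fA a))"
  using iso unfolding partial_scaffolding_iso_def graph_isomorphism_def graph_morphism_def over_simps
  by blast+

text \<open>The relation \<sim> is preserved in both directions, and the part of
  \<open>\<Sigma>'\<close> over \<open>S\<^sub>0'\<close> is a union of whole bundles. So the image
  of a bundle does not merely lie in a bundle but fills it.\<close>

lemma fV_bundle:
  assumes V: "V \<in> vertices S\<^sub>0" and x: "x \<in> V"
  shows "fV ` V \<in> vertices S\<^sub>0'" "vbundle \<Sigma>' (fV x) = fV ` V"
proof -
  have "fV x \<in> \<Union> (vertices S\<^sub>0')"
    using bij_betwE[OF fV_bij] V x by blast
  then obtain V' where V': "V' \<in> vertices S\<^sub>0'" "fV x \<in> V'" by blast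
  have vb: "vbundle \<Sigma> x = V" "vbundle \<Sigma>' (fV x) = V'"
    using S.vertex_bundleD(2)[OF S\<^sub>0_vertex[OF V] x] S'.vertex_bundleD(2)[OF S\<^sub>0'_vertex[OF V'(1)] V'(2)]
    by simp_all
  have "fV ` V = V'"
  proof
    show "fV ` V \<subseteq> V'"
      using vb fV_sim[of x] V x by blast
    show "V' \<subseteq> fV ` V"
    proof
      fix y assume y: "y \<in> V'"
      then have "y \<in> fV ` \<Union> (vertices S\<^sub>0)"
        using V'(1) bij_betw_imp_surj_on[OF fV_bij] by blast
      then obtain z where z: "z \<in> \<Union> (vertices S\<^sub>0)" "y = fV z" by blast
      then have "(x, z) \<in> sim \<Sigma>" using vb y fV_sim[of x z] V x by blast
      then show "y \<in> fV ` V" using z vb by blast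
    qed
  qed
  then show "fV ` V \<in> vertices S\<^sub>0'" "vbundle \<Sigma>' (fV x) = fV ` V" using V' vb by auto
qed

text \<open>Lying over a subtree depends only on the bundles of the two ends, so an arc bundle lies
  over it entirely or not at all.\<close>

lemma fA_bundle:
  assumes a: "a \<in> arcs_over"
  shows "fA ` abundle \<Sigma> a = abundle \<Sigma>' (fA a)" "abundle \<Sigma> a \<subseteq> arcs_over"
proof -
  have closed: "y \<in> \<Union> (vertices S\<^sub>0)" if "(x, y) \<in> sim \<Sigma>" "x \<in> \<Union> (vertices S\<^sub>0)" for x y
    using that S.vertex_bundleD(2)[OF S\<^sub>0_vertex] by blast
  have closed': "y \<in> \<Union> (vertices S\<^sub>0')" if "(x, y) \<in> sim \<Sigma>'" "x \<in> \<Union> (vertices S\<^sub>0')" for x y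
    using that S'.vertex_bundleD(2)[OF S\<^sub>0'_vertex] by blast
  show sub: "abundle \<Sigma> a \<subseteq> arcs_over"
    using a closed by (auto simp: arc_sim_def)
  have fa: "fA a \<in> arcs_over'" using bij_betwE[OF fA_bij] a by blast
  show "fA ` abundle \<Sigma> a = abundle \<Sigma>' (fA a)"
  proof
    show "fA ` abundle \<Sigma> a \<subseteq> abundle \<Sigma>' (fA a)"
      using fA_sim[OF a] sub by blast
    show "abundle \<Sigma>' (fA a) \<subseteq> fA ` abundle \<Sigma> a"
    proof
      fix b' assume b': "b' \<in> abundle \<Sigma>' (fA a)"
      then have "b' \<in> arrows (gr \<Sigma>')"
        "(origin (gr \<Sigma>') (fA a), origin (gr \<Sigma>') b') \<in> sim \<Sigma>'"
        "(terminus (gr \<Sigma>') (fA a), terminus (gr \<Sigma>') b') \<in> sim \<Sigma>'"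
        by (simp_all add: arc_sim_def)
      then have "b' \<in> arcs_over'" using fa closed' by blast
      then have "b' \<in> fA ` arcs_over"
        unfolding bij_betw_imp_surj_on[OF fA_bij] .
      then obtain b where b: "b' = fA b" "b \<in> arcs_over" by (rule imageE)
      then show "b' \<in> fA ` abundle \<Sigma> a" using fA_sim[OF a b(2)] b' by blast
    qed
  qed
qed

text \<open>The witness is the permutation of colours that \<open>fA\<close> induces on the bundle.
  Preservation of terminus and origin gives the equations at the two ends for this one
  \<open>k\<close>.\<close>

lemma fA_arc_match:
  assumes a: "a \<in> arcs_over"
  defines "A \<equiv> abundle \<Sigma> a" and "A' \<equiv> abundle \<Sigma>' (fA a)"
  shows "arc_match A A' (local_map \<G> \<Sigma> \<Sigma>' fV (origin (quot \<Sigma>) A))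
    (local_map \<G> \<Sigma> \<Sigma>' fV (terminus (quot \<Sigma>) A))"
proof -
  let ?Y = "apts \<G> (piA \<Sigma> A)"
  have a1: "a \<in> arrows (gr \<Sigma>)" "fA a \<in> arrows (gr \<Sigma>')"
    using a bij_betwE[OF fA_bij] by blast+
  have A: "A \<in> arrows (quot \<Sigma>)" and A': "A' \<in> arrows (quot \<Sigma>')"
    using S.arc_bundleI[OF a1(1)] S'.arc_bundleI[OF a1(2)] by (auto simp: A_def A'_def)
  have pi: "piA \<Sigma> A = piA \<Sigma>' A'" using fA_pi[OF a] by (simp add: A_def A'_def)
  have im: "fA ` A = A'" and sub: "A \<subseteq> arcs_over"
    using fA_bundle[OF a] by (simp_all add: A_def A'_def)
  have cA: "bij_betw (colA \<Sigma>) A ?Y" and cA': "bij_betw (colA \<Sigma>') A' ?Y"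
    using S.colA_bij[OF A] S'.colA_bij[OF A'] pi by simp_all
  have "bij_betw fA A A'"
    using bij_betw_subset[OF fA_bij sub im] .
  \<comment> \<open>The colour of the image under \<open>fA\<close> of the arc with the given
    colour.\<close>
  define k where "k = colA \<Sigma>' \<circ> (fA \<circ> inv_into A (colA \<Sigma>))"
  have k: "bij_betw k ?Y ?Y"
    unfolding k_def using bij_betw_trans[OF bij_betw_trans[OF bij_betw_inv_into[OF cA] \<open>bij_betw fA A A'\<close>] cA'] .
  have "local_map \<G> \<Sigma> \<Sigma>' fV (terminus (quot \<Sigma>) A) (bundle_map \<G> \<Sigma> A y) = bundle_map \<G> \<Sigma>' A' (k y) \<and>
    local_map \<G> \<Sigma> \<Sigma>' fV (origin (quot \<Sigma>) A) (bundle_map \<G> \<Sigma> (rev_arc (quot \<Sigma>) A) y) =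
      bundle_map \<G> \<Sigma>' (rev_arc (quot \<Sigma>') A') (k y)" if y: "y \<in> ?Y" for y
  proof -
    obtain b where b: "b \<in> A" "y = colA \<Sigma> b"
      using y bij_betw_imp_surj_on[OF cA] by (metis imageE)
    have kb: "k y = colA \<Sigma>' (fA b)"
      using b cA by (simp add: k_def bij_betw_def)
    have b': "fA b \<in> A'" "b \<in> arcs_over" using b im sub by blast+
    have loc: "local_map \<G> \<Sigma> \<Sigma>' fV V (colV \<Sigma> x) = colV \<Sigma>' (fV x)" if "V \<in> vertices (quot \<Sigma>)" "x \<in> V" for V x
      by (rule local_map_colV[OF S.colV_bij[OF that(1)] that(2)])
    show ?thesis
      using S.bundle_map_col[OF A b(1)] S.bundle_map_rev_col[OF A b(1)]
        S'.bundle_map_col[OF A' b'(1)] S'.bundle_map_rev_col[OF A' b'(1)]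
        loc[OF S.arc_endsD(1)[OF A] S.arc_bundleD(3)[OF A b(1)]]
        loc[OF S.arc_endsD(2)[OF A] S.arc_bundleD(4)[OF A b(1)]]
        fA_ends[OF b'(2)] kb b(2)
      by simp
  qed
  then show ?thesis
    using pi k unfolding arc_match_def colour_compatible_def by blast
qed

lemma initial_matching: "matching ((\<lambda>V. (V, fV ` V, local_map \<G> \<Sigma> \<Sigma>' fV V)) ` vertices S\<^sub>0)"
  unfolding matching_def
proof (intro conjI ballI; (elim imageE)?)
  fix r V assume V: "V \<in> vertices S\<^sub>0" and r: "r = (V, fV ` V, local_map \<G> \<Sigma> \<Sigma>' fV V)"
  obtain x where x: "x \<in> V" using S.vertex_bundle_nonempty[OF S\<^sub>0_vertex[OF V]] by blast
  have "piV \<Sigma> V = piV \<Sigma>' (fV ` V)"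
    using fV_pi[of x] V x fV_bundle(2)[OF V x] S.vertex_bundleD(2)[OF S\<^sub>0_vertex[OF V] x] by auto
  moreover have "local_map \<G> \<Sigma> \<Sigma>' fV V \<in> perms (vact \<G> (piV \<Sigma> V))"
    using accept V by (simp add: acceptable_def)
  ultimately show "local_iso r"
    using V fV_bundle(1)[OF V x] S\<^sub>0_vertex S\<^sub>0'_vertex by (simp add: r local_iso_def)
next
  fix r s V W assume V: "V \<in> vertices S\<^sub>0" and r: "r = (V, fV ` V, local_map \<G> \<Sigma> \<Sigma>' fV V)"
    and W: "W \<in> vertices S\<^sub>0" and s: "s = (W, fV ` W, local_map \<G> \<Sigma> \<Sigma>' fV W)"
  have inj: "inj_on fV (\<Union> (vertices S\<^sub>0))" using fV_bij by (simp add: bij_betw_def)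
  have bundle_inj: "V = W" if "fV ` V = fV ` W"
    using that inj_on_image_eq_iff[OF inj, of V W] V W by blast
  have fwd: "\<exists>A' \<in> arrows (quot \<Sigma>'). origin (quot \<Sigma>') A' = fV ` V \<and> terminus (quot \<Sigma>') A' = fV ` W \<and>
      arc_match A A' (local_map \<G> \<Sigma> \<Sigma>' fV V) (local_map \<G> \<Sigma> \<Sigma>' fV W)"
    if A: "A \<in> arrows (quot \<Sigma>)" "origin (quot \<Sigma>) A = V" "terminus (quot \<Sigma>) A = W" for A
  proof -
    obtain a where a: "a \<in> A" using S.arc_bundle_nonempty[OF A(1)] by blast
    note aD = S.arc_bundleD[OF A(1) a]
    have ao: "a \<in> arcs_over" using aD A V W by blast
    have fa: "fA a \<in> arrows (gr \<Sigma>')" using bij_betwE[OF fA_bij] ao by blast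
    show ?thesis
    proof (intro bexI conjI)
      show "abundle \<Sigma>' (fA a) \<in> arrows (quot \<Sigma>')" by (rule S'.arc_bundleI(1)[OF fa])
      show "origin (quot \<Sigma>') (abundle \<Sigma>' (fA a)) = fV ` V"
        using quot_abundle(1)[OF S'.graph S'.sim_equiv fa] fA_ends(1)[OF ao] fV_bundle(2)[OF V] aD(3) A(2)
        by simp
      show "terminus (quot \<Sigma>') (abundle \<Sigma>' (fA a)) = fV ` W"
        using quot_abundle(2)[OF S'.graph S'.sim_equiv fa] fA_ends(2)[OF ao] fV_bundle(2)[OF W] aD(4) A(3)
        by simp
      show "arc_match A (abundle \<Sigma>' (fA a)) (local_map \<G> \<Sigma> \<Sigma>' fV V) (local_map \<G> \<Sigma> \<Sigma>' fV W)"
        using fA_arc_match[OF ao] aD(2) A(2,3) by simp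
    qed
  qed
  have bwd: "\<exists>A \<in> arrows (quot \<Sigma>). origin (quot \<Sigma>) A = V \<and> terminus (quot \<Sigma>) A = W \<and>
      arc_match A A' (local_map \<G> \<Sigma> \<Sigma>' fV V) (local_map \<G> \<Sigma> \<Sigma>' fV W)"
    if A': "A' \<in> arrows (quot \<Sigma>')" "origin (quot \<Sigma>') A' = fV ` V" "terminus (quot \<Sigma>') A' = fV ` W" for A'
  proof -
    obtain a' where a': "a' \<in> A'" using S'.arc_bundle_nonempty[OF A'(1)] by blast
    note aD' = S'.arc_bundleD[OF A'(1) a']
    have "fV ` V \<subseteq> \<Union> (vertices S\<^sub>0')" "fV ` W \<subseteq> \<Union> (vertices S\<^sub>0')"
      using bij_betw_imp_surj_on[OF fV_bij] V W by blast+
    then have "a' \<in> arcs_over'" using aD' A' by blast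
    then have "a' \<in> fA ` arcs_over"
      unfolding bij_betw_imp_surj_on[OF fA_bij] .
    then obtain a where a: "a' = fA a" "a \<in> arcs_over" by (rule imageE)
    have a1: "a \<in> arrows (gr \<Sigma>)" using a(2) by blast
    have "fV (origin (gr \<Sigma>) a) \<in> fV ` V" "fV (terminus (gr \<Sigma>) a) \<in> fV ` W"
      using fA_ends[OF a(2)] aD'(3,4) A' a(1) by simp_all
    then have "origin (gr \<Sigma>) a \<in> V" "terminus (gr \<Sigma>) a \<in> W"
      using inj_on_image_mem_iff[OF inj] a(2) V W by blast+
    then have ends: "origin (quot \<Sigma>) (abundle \<Sigma> a) = V" "terminus (quot \<Sigma>) (abundle \<Sigma> a) = W"
      using quot_abundle(1,2)[OF S.graph S.sim_equiv a1] S.vertex_bundleD(2)[OF S\<^sub>0_vertex] V W by simp_all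
    show ?thesis
      using S.arc_bundleI(1)[OF a1] ends fA_arc_match[OF a(2)] aD'(2) a(1) by auto
  qed
  show "fits r s"
    unfolding fits_def r s split_conv
  proof (intro conjI ballI impI; (elim conjE)?)
    fix A assume "A \<in> arrows (quot \<Sigma>)" "origin (quot \<Sigma>) A = V" "terminus (quot \<Sigma>) A = W"
    then show "\<exists>A' \<in> arrows (quot \<Sigma>'). origin (quot \<Sigma>') A' = fV ` V \<and> terminus (quot \<Sigma>') A' = fV ` W \<and>
      arc_match A A' (local_map \<G> \<Sigma> \<Sigma>' fV V) (local_map \<G> \<Sigma> \<Sigma>' fV W)" by (rule fwd)
  next
    fix A' assume "A' \<in> arrows (quot \<Sigma>')" "origin (quot \<Sigma>') A' = fV ` V" "terminus (quot \<Sigma>') A' = fV ` W"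
    then show "\<exists>A \<in> arrows (quot \<Sigma>). origin (quot \<Sigma>) A = V \<and> terminus (quot \<Sigma>) A = W \<and>
      arc_match A A' (local_map \<G> \<Sigma> \<Sigma>' fV V) (local_map \<G> \<Sigma> \<Sigma>' fV W)" by (rule bwd)
  qed (use bundle_inj in blast)+
next
  have conn: "strongly_connected (dg S\<^sub>0)"
    using subtree is_graph_connected by (auto simp: is_subtree_def is_tree_def)
  \<comment> \<open>A matching asks for connectedness of the induced subgraph on its domain. This is
    inherited from \<open>S\<^sub>0\<close>, a connected subgraph on the same vertices.\<close>
  have sub: "subgraph (dg S\<^sub>0) (dg (quot \<Sigma>) \<restriction> vertices S\<^sub>0)"
    using subtree subgraph_induce_subgraphI2 by (auto simp: is_subtree_def is_subgraph_def)
  have "fst ` (\<lambda>V. (V, fV ` V, local_map \<G> \<Sigma> \<Sigma>' fV V)) ` vertices S\<^sub>0 = vertices S\<^sub>0"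
    by (simp add: image_image)
  then show "strongly_connected (dg (quot \<Sigma>) \<restriction> fst ` (\<lambda>V. (V, fV ` V, local_map \<G> \<Sigma> \<Sigma>' fV V)) ` vertices S\<^sub>0)"
    using conn pre_digraph.reachable_mono[OF _ sub] by (simp add: strongly_connected_def)
qed

end

section \<open>From a total matching to a scaffolding isomorphism\<close>

context scaffolding_pair
begin

text \<open>Colours are bijective on bundles, so an image bundle and a local map determine the
  vertex map on each bundle, and the arcs follow from their ends. The last conjunct ties the result
  to the triples of \<open>R\<close>; agreement with the initial map is read off from it.\<close>

lemma matching_iso:
  assumes R: "matching R" and dom: "fst ` R = vertices (quot \<Sigma>)"
    and cod: "(fst \<circ> snd) ` R = vertices (quot \<Sigma>')"
  shows "\<exists>FV FA. scaffolding_iso \<Sigma> \<Sigma>' FV FA \<and> acceptable \<G> \<Sigma> (quot \<Sigma>) \<Sigma>' FV \<and>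
    (\<forall>(V, V', g) \<in> R. \<forall>x \<in> V. FV x \<in> V' \<and> colV \<Sigma>' (FV x) = g (colV \<Sigma> x))"
proof -
  have "\<forall>V \<in> vertices (quot \<Sigma>). \<exists>q. (V, q) \<in> R"
    using dom by force
  then obtain q where q: "\<And>V. V \<in> vertices (quot \<Sigma>) \<Longrightarrow> (V, q V) \<in> R"
    using bchoice[of "vertices (quot \<Sigma>)"] by metis
  define \<phi> where "\<phi> V = fst (q V)" for V
  define \<gamma> where "\<gamma> V = snd (q V)" for V
  have \<phi>\<gamma>: "(V, \<phi> V, \<gamma> V) \<in> R" if "V \<in> vertices (quot \<Sigma>)" for V
    using q[OF that] by (simp add: \<phi>_def \<gamma>_def)
  note RD = matchingD[OF R \<phi>\<gamma>]
  have \<phi>_eq: "\<phi> V = V' \<and> \<gamma> V = g" if "(V, V', g) \<in> R" for V V' g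
    using matching_pairD(1,2)[OF R \<phi>\<gamma>[OF matchingD(1)[OF R that]] that] by blast
  have \<phi>_inj: "\<phi> V = \<phi> W \<longleftrightarrow> V = W" if "V \<in> vertices (quot \<Sigma>)" "W \<in> vertices (quot \<Sigma>)" for V W
    using matching_pairD(1)[OF R \<phi>\<gamma>[OF that(1)] \<phi>\<gamma>[OF that(2)]] by simp
  have \<phi>_surj: "\<exists>V \<in> vertices (quot \<Sigma>). \<phi> V = V'" if V': "V' \<in> vertices (quot \<Sigma>')" for V'
  proof -
    have "V' \<in> (fst \<circ> snd) ` R" using V' cod by simp
    then obtain V g where "(V, V', g) \<in> R" by force
    then show ?thesis using \<phi>_eq matchingD(1)[OF R] by blast
  qed
  have \<gamma>_bij: "bij_betw (\<gamma> V) (vpts \<G> (piV \<Sigma> V)) (vpts \<G> (piV \<Sigma> V))" if "V \<in> vertices (quot \<Sigma>)" for V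
    by (rule perms_bij[OF S.pi_vertex_action[OF that] RD(4)[OF that]])
  \<comment> \<open>The vertex of the image bundle whose colour is obtained from that of
    \<open>x\<close> by the local map.\<close>
  define FV where "FV x = inv_into (\<phi> (vbundle \<Sigma> x)) (colV \<Sigma>') (\<gamma> (vbundle \<Sigma> x) (colV \<Sigma> x))" for x
  have FV: "bij_betw FV V (\<phi> V)" "\<And>x. x \<in> V \<Longrightarrow> colV \<Sigma>' (FV x) = \<gamma> V (colV \<Sigma> x)"
    if V: "V \<in> vertices (quot \<Sigma>)" for V
  proof -
    note c = S.colV_bij[OF V]
    have c': "bij_betw (colV \<Sigma>') (\<phi> V) (vpts \<G> (piV \<Sigma> V))"
      using S'.colV_bij[OF RD(2)[OF V]] RD(3)[OF V] by simp
    have eq: "FV x = inv_into (\<phi> V) (colV \<Sigma>') (\<gamma> V (colV \<Sigma> x))" if "x \<in> V" for x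
      by (simp add: FV_def S.vertex_bundleD(2)[OF V that])
    have "bij_betw (inv_into (\<phi> V) (colV \<Sigma>') \<circ> (\<gamma> V \<circ> colV \<Sigma>)) V (\<phi> V)"
      by (rule bij_betw_trans[OF bij_betw_trans[OF c \<gamma>_bij[OF V]] bij_betw_inv_into[OF c']])
    then show "bij_betw FV V (\<phi> V)"
      by (rule bij_betw_cong[THEN iffD1, rotated]) (simp add: eq)
    show "colV \<Sigma>' (FV x) = \<gamma> V (colV \<Sigma> x)" if "x \<in> V" for x
    proof -
      have "\<gamma> V (colV \<Sigma> x) \<in> vpts \<G> (piV \<Sigma> V)"
        using bij_betwE[OF \<gamma>_bij[OF V]] bij_betwE[OF c] that by blast
      then show ?thesis using eq[OF that] bij_betw_inv_into_right[OF c'] by simp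
    qed
  qed
  have FV_mem: "FV x \<in> \<phi> V" if "V \<in> vertices (quot \<Sigma>)" "x \<in> V" for V x
    using bij_betwE[OF FV(1)[OF that(1)]] that(2) by blast
  have FV_eqI: "y = FV x" if "V \<in> vertices (quot \<Sigma>)" "x \<in> V" "y \<in> \<phi> V" "colV \<Sigma>' y = \<gamma> V (colV \<Sigma> x)" for V x y
    using inj_onD[OF bij_betw_imp_inj_on[OF S'.colV_bij[OF RD(2)[OF that(1)]]] _ that(3) FV_mem[OF that(1,2)]]
      FV(2)[OF that(1,2)] that(4) by simp
  have FV_bundle: "vbundle \<Sigma>' (FV x) = \<phi> (vbundle \<Sigma> x)" if "x \<in> vertices (gr \<Sigma>)" for x
    using S'.vertex_bundleD(2)[OF RD(2)] FV_mem S.vertex_bundleI[OF that] by blast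
  have FV_vertex: "FV x \<in> vertices (gr \<Sigma>')" if "x \<in> vertices (gr \<Sigma>)" for x
    using S'.vertex_bundleD(1)[OF RD(2) FV_mem] S.vertex_bundleI[OF that] by blast
  have FV_sim: "(x, y) \<in> sim \<Sigma> \<longleftrightarrow> (FV x, FV y) \<in> sim \<Sigma>'"
    if x: "x \<in> vertices (gr \<Sigma>)" and y: "y \<in> vertices (gr \<Sigma>)" for x y
    using eq_equiv_class_iff[OF S.sim_equiv x y] eq_equiv_class_iff[OF S'.sim_equiv FV_vertex[OF x] FV_vertex[OF y]]
      FV_bundle[OF x] FV_bundle[OF y] \<phi>_inj[OF S.vertex_bundleI(1)[OF x] S.vertex_bundleI(1)[OF y]] by simp
  have FV_bij: "bij_betw FV (vertices (gr \<Sigma>)) (vertices (gr \<Sigma>'))"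
  proof (intro bij_betw_imageI inj_onI)
    fix x y assume xy: "x \<in> vertices (gr \<Sigma>)" "y \<in> vertices (gr \<Sigma>)" "FV x = FV y"
    then have "(FV x, FV y) \<in> sim \<Sigma>'"
      using FV_vertex S'.sim_equiv by (auto simp: equiv_def refl_on_def)
    then have "y \<in> vbundle \<Sigma> x" using FV_sim xy by simp
    then show "x = y"
      using FV(1)[OF S.vertex_bundleI(1)[OF xy(1)]] S.vertex_bundleI(2)[OF xy(1)] xy(3)
      by (auto simp: bij_betw_def dest: inj_onD)
  next
    show "FV ` vertices (gr \<Sigma>) = vertices (gr \<Sigma>')"
    proof
      show "FV ` vertices (gr \<Sigma>) \<subseteq> vertices (gr \<Sigma>')" using FV_vertex by blast
      show "vertices (gr \<Sigma>') \<subseteq> FV ` vertices (gr \<Sigma>)"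
      proof
        fix y assume y: "y \<in> vertices (gr \<Sigma>')"
        obtain V where V: "V \<in> vertices (quot \<Sigma>)" "\<phi> V = vbundle \<Sigma>' y"
          using \<phi>_surj[OF S'.vertex_bundleI(1)[OF y]] by blast
        then have "y \<in> FV ` V"
          using bij_betw_imp_surj_on[OF FV(1)[OF V(1)]] S'.vertex_bundleI(2)[OF y] by simp
        then show "y \<in> FV ` vertices (gr \<Sigma>)" using S.vertex_bundleD(1)[OF V(1)] by blast
      qed
    qed
  qed
  \<comment> \<open>The arc \<open>b'\<close> is the one to which \<open>k\<close> sends the colour
    of \<open>b\<close>. At each end the maps \<Psi> turn this into an equation of vertex colours,
    and a colour singles out a vertex of its bundle.\<close>
  have ends: "origin (gr \<Sigma>') b' = FV (origin (gr \<Sigma>) b) \<and> terminus (gr \<Sigma>') b' = FV (terminus (gr \<Sigma>) b)"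
    if A: "A \<in> arrows (quot \<Sigma>)" and A': "A' \<in> arrows (quot \<Sigma>')"
      and e: "origin (quot \<Sigma>') A' = \<phi> (origin (quot \<Sigma>) A)" "terminus (quot \<Sigma>') A' = \<phi> (terminus (quot \<Sigma>) A)"
      and k: "\<And>y. y \<in> apts \<G> (piA \<Sigma> A) \<Longrightarrow> \<gamma> (terminus (quot \<Sigma>) A) (bundle_map \<G> \<Sigma> A y) = bundle_map \<G> \<Sigma>' A' (k y) \<and>
        \<gamma> (origin (quot \<Sigma>) A) (bundle_map \<G> \<Sigma> (rev_arc (quot \<Sigma>) A) y) =
          bundle_map \<G> \<Sigma>' (rev_arc (quot \<Sigma>') A') (k y)"
      and b: "b \<in> A" "b' \<in> A'" "colA \<Sigma>' b' = k (colA \<Sigma> b)" for A A' k b b'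
  proof -
    have "colA \<Sigma> b \<in> apts \<G> (piA \<Sigma> A)" using bij_betwE[OF S.colA_bij[OF A]] b(1) by blast
    from k[OF this] show ?thesis
      using FV_eqI[OF S.arc_endsD(1)[OF A] S.arc_bundleD(3)[OF A b(1)], of "origin (gr \<Sigma>') b'"]
        FV_eqI[OF S.arc_endsD(2)[OF A] S.arc_bundleD(4)[OF A b(1)], of "terminus (gr \<Sigma>') b'"]
        S'.arc_bundleD(3,4)[OF A' b(2)] e b(3)
        S.bundle_map_col[OF A b(1)] S.bundle_map_rev_col[OF A b(1)]
        S'.bundle_map_col[OF A' b(2)] S'.bundle_map_rev_col[OF A' b(2)] by simp
  qed
  have lift: "\<exists>b' \<in> arrows (gr \<Sigma>'). origin (gr \<Sigma>') b' = FV (origin (gr \<Sigma>) b) \<and>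
      terminus (gr \<Sigma>') b' = FV (terminus (gr \<Sigma>) b) \<and> piA \<Sigma> (abundle \<Sigma> b) = piA \<Sigma>' (abundle \<Sigma>' b')"
    if b: "b \<in> arrows (gr \<Sigma>)" for b
  proof -
    let ?A = "abundle \<Sigma> b"
    note A = S.arc_bundleI[OF b]
    obtain A' where A': "A' \<in> arrows (quot \<Sigma>')" "origin (quot \<Sigma>') A' = \<phi> (origin (quot \<Sigma>) ?A)"
      "terminus (quot \<Sigma>') A' = \<phi> (terminus (quot \<Sigma>) ?A)"
      "arc_match ?A A' (\<gamma> (origin (quot \<Sigma>) ?A)) (\<gamma> (terminus (quot \<Sigma>) ?A))"
      using matching_pairD(3)[OF R \<phi>\<gamma>[OF S.arc_endsD(1)[OF A(1)]] \<phi>\<gamma>[OF S.arc_endsD(2)[OF A(1)]] A(1) refl refl]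
      by blast
    have pi: "piA \<Sigma> ?A = piA \<Sigma>' A'" using A'(4) by (simp add: arc_match_def)
    obtain k where k: "bij_betw k (apts \<G> (piA \<Sigma> ?A)) (apts \<G> (piA \<Sigma> ?A))"
      "\<And>y. y \<in> apts \<G> (piA \<Sigma> ?A) \<Longrightarrow> \<gamma> (terminus (quot \<Sigma>) ?A) (bundle_map \<G> \<Sigma> ?A y) = bundle_map \<G> \<Sigma>' A' (k y) \<and>
        \<gamma> (origin (quot \<Sigma>) ?A) (bundle_map \<G> \<Sigma> (rev_arc (quot \<Sigma>) ?A) y) =
          bundle_map \<G> \<Sigma>' (rev_arc (quot \<Sigma>') A') (k y)"
      using A'(4) by (auto simp: arc_match_def colour_compatible_def)
    have "k (colA \<Sigma> b) \<in> apts \<G> (piA \<Sigma>' A')"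
      using bij_betwE[OF k(1)] bij_betwE[OF S.colA_bij[OF A(1)]] A(2) pi by metis
    then have "k (colA \<Sigma> b) \<in> colA \<Sigma>' ` A'"
      using bij_betw_imp_surj_on[OF S'.colA_bij[OF A'(1)]] by simp
    then obtain b' where b': "k (colA \<Sigma> b) = colA \<Sigma>' b'" "b' \<in> A'" by (rule imageE)
    show ?thesis
      using ends[OF A(1) A'(1-3) k(2) A(2) b'(2) b'(1)[symmetric]] S'.arc_bundleD(1,2)[OF A'(1) b'(2)] pi
      by auto
  qed
  \<comment> \<open>The backward arc clause together with surjectivity of \<open>k\<close> on
    colours; this becomes surjectivity of the arc map.\<close>
  have descend: "\<exists>b \<in> arrows (gr \<Sigma>). origin (gr \<Sigma>') b' = FV (origin (gr \<Sigma>) b) \<and>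
      terminus (gr \<Sigma>') b' = FV (terminus (gr \<Sigma>) b)"
    if b': "b' \<in> arrows (gr \<Sigma>')" for b'
  proof -
    let ?A' = "abundle \<Sigma>' b'"
    note A' = S'.arc_bundleI[OF b']
    obtain V where V: "V \<in> vertices (quot \<Sigma>)" "\<phi> V = origin (quot \<Sigma>') ?A'"
      using \<phi>_surj[OF S'.arc_endsD(1)[OF A'(1)]] by blast
    obtain W where W: "W \<in> vertices (quot \<Sigma>)" "\<phi> W = terminus (quot \<Sigma>') ?A'"
      using \<phi>_surj[OF S'.arc_endsD(2)[OF A'(1)]] by blast
    obtain A where A: "A \<in> arrows (quot \<Sigma>)" "origin (quot \<Sigma>) A = V" "terminus (quot \<Sigma>) A = W"
      "arc_match A ?A' (\<gamma> V) (\<gamma> W)"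
      using matching_pairD(4)[OF R \<phi>\<gamma>[OF V(1)] \<phi>\<gamma>[OF W(1)] A'(1) V(2)[symmetric] W(2)[symmetric]] by blast
    have pi: "piA \<Sigma> A = piA \<Sigma>' ?A'" using A(4) by (simp add: arc_match_def)
    obtain k where k: "bij_betw k (apts \<G> (piA \<Sigma> A)) (apts \<G> (piA \<Sigma> A))"
      "\<And>y. y \<in> apts \<G> (piA \<Sigma> A) \<Longrightarrow> \<gamma> (terminus (quot \<Sigma>) A) (bundle_map \<G> \<Sigma> A y) = bundle_map \<G> \<Sigma>' ?A' (k y) \<and>
        \<gamma> (origin (quot \<Sigma>) A) (bundle_map \<G> \<Sigma> (rev_arc (quot \<Sigma>) A) y) =
          bundle_map \<G> \<Sigma>' (rev_arc (quot \<Sigma>') ?A') (k y)"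
      using A(2-4) by (auto simp: arc_match_def colour_compatible_def)
    have "colA \<Sigma>' b' \<in> apts \<G> (piA \<Sigma> A)"
      using bij_betwE[OF S'.colA_bij[OF A'(1)]] A'(2) pi by simp
    then have "colA \<Sigma>' b' \<in> (k \<circ> colA \<Sigma>) ` A"
      using bij_betw_imp_surj_on[OF bij_betw_trans[OF S.colA_bij[OF A(1)] k(1)]] by simp
    then obtain b where b: "colA \<Sigma>' b' = (k \<circ> colA \<Sigma>) b" "b \<in> A" by (rule imageE)
    have e: "origin (quot \<Sigma>') ?A' = \<phi> (origin (quot \<Sigma>) A)" "terminus (quot \<Sigma>') ?A' = \<phi> (terminus (quot \<Sigma>) A)"
      using A V W by simp_all
    show ?thesis
      using ends[OF A(1) A'(1) e k(2) b(2) A'(2)] b(1) S.arc_bundleD(1)[OF A(1) b(2)] by auto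
  qed
  \<comment> \<open>Existence is \<open>lift\<close>, and by \<open>arc_eqI\<close> the ends
    determine \<open>b'\<close>, so nothing depends on the choice.\<close>
  define FA where "FA b = (SOME b'. b' \<in> arrows (gr \<Sigma>') \<and> origin (gr \<Sigma>') b' = FV (origin (gr \<Sigma>) b) \<and>
      terminus (gr \<Sigma>') b' = FV (terminus (gr \<Sigma>) b) \<and> piA \<Sigma> (abundle \<Sigma> b) = piA \<Sigma>' (abundle \<Sigma>' b'))" for b
  have FA: "FA b \<in> arrows (gr \<Sigma>')" "origin (gr \<Sigma>') (FA b) = FV (origin (gr \<Sigma>) b)"
    "terminus (gr \<Sigma>') (FA b) = FV (terminus (gr \<Sigma>) b)" "piA \<Sigma> (abundle \<Sigma> b) = piA \<Sigma>' (abundle \<Sigma>' (FA b))"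
    if "b \<in> arrows (gr \<Sigma>)" for b
    using someI_ex[OF lift[OF that, unfolded Bex_def], folded FA_def] by blast+
  have gr_ends: "origin (gr \<Sigma>) b \<in> vertices (gr \<Sigma>)" "terminus (gr \<Sigma>) b \<in> vertices (gr \<Sigma>)"
    if "b \<in> arrows (gr \<Sigma>)" for b
    using S.graph that by (auto simp: is_graph_def wf_digraph_def)
  have FV_inj: "x = y" if "x \<in> vertices (gr \<Sigma>)" "y \<in> vertices (gr \<Sigma>)" "FV x = FV y" for x y
    using FV_bij that by (auto simp: bij_betw_def dest: inj_onD)
  have FA_bij: "bij_betw FA (arrows (gr \<Sigma>)) (arrows (gr \<Sigma>'))"
  proof (intro bij_betw_imageI inj_onI)
    fix a b assume ab: "a \<in> arrows (gr \<Sigma>)" "b \<in> arrows (gr \<Sigma>)" "FA a = FA b"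
    then have "FV (origin (gr \<Sigma>) a) = FV (origin (gr \<Sigma>) b)" "FV (terminus (gr \<Sigma>) a) = FV (terminus (gr \<Sigma>) b)"
      using FA(2,3)[OF ab(1)] FA(2,3)[OF ab(2)] by simp_all
    then show "a = b"
      using S.arc_eqI[OF ab(1,2)] FV_inj gr_ends ab(1,2) by blast
  next
    show "FA ` arrows (gr \<Sigma>) = arrows (gr \<Sigma>')"
    proof
      show "FA ` arrows (gr \<Sigma>) \<subseteq> arrows (gr \<Sigma>')" using FA(1) by blast
      show "arrows (gr \<Sigma>') \<subseteq> FA ` arrows (gr \<Sigma>)"
      proof
        fix b' assume b': "b' \<in> arrows (gr \<Sigma>')"
        obtain b where b: "b \<in> arrows (gr \<Sigma>)" "origin (gr \<Sigma>') b' = FV (origin (gr \<Sigma>) b)"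
          "terminus (gr \<Sigma>') b' = FV (terminus (gr \<Sigma>) b)"
          using descend[OF b'] by blast
        have "b' = FA b"
          using S'.arc_eqI[OF b' FA(1)[OF b(1)]] FA(2,3)[OF b(1)] b(2,3) by simp
        then show "b' \<in> FA ` arrows (gr \<Sigma>)" using b(1) by blast
      qed
    qed
  qed
  \<comment> \<open>Both sides are arcs with the same ends, so \<open>arc_eqI\<close> identifies
    them.\<close>
  have FA_rev: "rev_arc (gr \<Sigma>') (FA b) = FA (rev_arc (gr \<Sigma>) b)" if b: "b \<in> arrows (gr \<Sigma>)" for b
  proof -
    note r = is_graph_revD[OF S.graph b] and r' = is_graph_revD[OF S'.graph FA(1)[OF b]]
    show ?thesis
      using S'.arc_eqI[OF r'(1) FA(1)[OF r(1)]] FA(2,3)[OF b] FA(2,3)[OF r(1)] r r' by simp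
  qed
  have "graph_isomorphism (over \<Sigma> (quot \<Sigma>)) (over \<Sigma>' (quot \<Sigma>')) FV FA"
    unfolding graph_isomorphism_def graph_morphism_def S.over_quot_simps S'.over_quot_simps ends_over rev_over
    using FV_bij FA_bij FV_vertex FA(1-3) FA_rev by auto
  moreover have "(a, b) \<in> arc_sim \<Sigma> \<longleftrightarrow> (FA a, FA b) \<in> arc_sim \<Sigma>'"
    if ab: "a \<in> arrows (gr \<Sigma>)" "b \<in> arrows (gr \<Sigma>)" for a b
    using FV_sim[OF gr_ends(1)[OF ab(1)] gr_ends(1)[OF ab(2)]]
      FV_sim[OF gr_ends(2)[OF ab(1)] gr_ends(2)[OF ab(2)]] FA(1-3)[OF ab(1)] FA(1-3)[OF ab(2)] ab
    by (simp add: arc_sim_def)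
  moreover have "piV \<Sigma> (vbundle \<Sigma> x) = piV \<Sigma>' (vbundle \<Sigma>' (FV x))" if "x \<in> vertices (gr \<Sigma>)" for x
    using RD(3)[OF S.vertex_bundleI(1)[OF that]] FV_bundle[OF that] by simp
  ultimately have "scaffolding_iso \<Sigma> \<Sigma>' FV FA"
    unfolding scaffolding_iso_def partial_scaffolding_iso_def S.over_quot_simps S'.over_quot_simps
    using FV_sim FA(4) by blast
  \<comment> \<open>Both maps are extensional on the colour set, so agreement on colours makes the
    local map an element of the vertex group.\<close>
  moreover have "local_map \<G> \<Sigma> \<Sigma>' FV V = \<gamma> V" if V: "V \<in> vertices (quot \<Sigma>)" for V
  proof (rule extensionalityI)
    show "local_map \<G> \<Sigma> \<Sigma>' FV V \<in> extensional (vpts \<G> (piV \<Sigma> V))" by (simp add: local_map_def)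
    show "\<gamma> V \<in> extensional (vpts \<G> (piV \<Sigma> V))"
      by (rule perms_extensional[OF S.pi_vertex_action[OF V] RD(4)[OF V]])
    fix z assume "z \<in> vpts \<G> (piV \<Sigma> V)"
    then have "z \<in> colV \<Sigma> ` V" using bij_betw_imp_surj_on[OF S.colV_bij[OF V]] by simp
    then obtain x where x: "z = colV \<Sigma> x" "x \<in> V" by (rule imageE)
    then show "local_map \<G> \<Sigma> \<Sigma>' FV V z = \<gamma> V z"
      using local_map_colV[OF S.colV_bij[OF V] x(2), where \<Sigma>' = \<Sigma>' and fV = FV] FV(2)[OF V x(2)]
      by simp
  qed
  then have "acceptable \<G> \<Sigma> (quot \<Sigma>) \<Sigma>' FV"
    using RD(4) by (simp add: acceptable_def)
  moreover have "FV x \<in> V' \<and> colV \<Sigma>' (FV x) = g (colV \<Sigma> x)" if "(V, V', g) \<in> R" "x \<in> V" for V V' g x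
    using \<phi>_eq[OF that(1)] matchingD(1)[OF R that(1)] FV_mem FV(2) that(2) by blast
  ultimately show ?thesis by blast
qed

end

context acceptable_partial_iso
begin

text \<open>The triples of the initial matching survive in the total one. Over
  \<open>S\<^sub>0\<close> the two vertex maps therefore send a vertex into the same bundle with the
  same colour, hence to the same vertex; the arc maps agree because their values have the same
  ends.\<close>

lemma acceptable_extension:
  "\<exists>FV FA. scaffolding_iso \<Sigma> \<Sigma>' FV FA \<and> acceptable \<G> \<Sigma> (quot \<Sigma>) \<Sigma>' FV \<and>
    (\<forall>x \<in> vertices (over \<Sigma> S\<^sub>0). FV x = fV x) \<and> (\<forall>x \<in> arrows (over \<Sigma> S\<^sub>0). FA x = fA x)"
proof -
  obtain R where R: "matching R" "(\<lambda>V. (V, fV ` V, local_map \<G> \<Sigma> \<Sigma>' fV V)) ` vertices S\<^sub>0 \<subseteq> R"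
    "fst ` R = vertices (quot \<Sigma>)" "(fst \<circ> snd) ` R = vertices (quot \<Sigma>')"
    by (rule matching_total[OF initial_matching]) (rule that)
  obtain FV FA where F: "scaffolding_iso \<Sigma> \<Sigma>' FV FA" "acceptable \<G> \<Sigma> (quot \<Sigma>) \<Sigma>' FV"
    and col: "\<forall>(V, V', g) \<in> R. \<forall>x \<in> V. FV x \<in> V' \<and> colV \<Sigma>' (FV x) = g (colV \<Sigma> x)"
    using matching_iso[OF R(1,3,4)] by blast
  have eV: "FV x = fV x" if x: "x \<in> \<Union> (vertices S\<^sub>0)" for x
  proof -
    obtain V where V: "V \<in> vertices S\<^sub>0" "x \<in> V" using x by blast
    note c = S.colV_bij[OF S\<^sub>0_vertex[OF V(1)]]
    have "(V, fV ` V, local_map \<G> \<Sigma> \<Sigma>' fV V) \<in> R" using R(2) V(1) by blast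
    then have "FV x \<in> fV ` V \<and> colV \<Sigma>' (FV x) = local_map \<G> \<Sigma> \<Sigma>' fV V (colV \<Sigma> x)"
      using col V(2) by fast
    then have "FV x \<in> fV ` V" "colV \<Sigma>' (FV x) = colV \<Sigma>' (fV x)"
      using local_map_colV[OF c V(2), where \<Sigma>' = \<Sigma>' and fV = fV] by simp_all
    moreover have "inj_on (colV \<Sigma>') (fV ` V)"
      using S'.colV_bij[OF S\<^sub>0'_vertex[OF fV_bundle(1)[OF V]]] by (simp add: bij_betw_def)
    ultimately show ?thesis using V(2) by (auto dest: inj_onD)
  qed
  have "FA a = fA a" if a: "a \<in> arcs_over" for a
  proof (rule S'.arc_eqI)
    have a1: "a \<in> arrows (gr \<Sigma>)" using a by blast
    have "graph_morphism (over \<Sigma> (quot \<Sigma>)) (over \<Sigma>' (quot \<Sigma>')) FV FA"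
      using F(1) by (simp add: scaffolding_iso_def partial_scaffolding_iso_def graph_isomorphism_def)
    then have "FA a \<in> arrows (gr \<Sigma>')" "origin (gr \<Sigma>') (FA a) = FV (origin (gr \<Sigma>) a)"
      "terminus (gr \<Sigma>') (FA a) = FV (terminus (gr \<Sigma>) a)"
      using a1 unfolding graph_morphism_def S.over_quot_simps S'.over_quot_simps ends_over by blast+
    then show "FA a \<in> arrows (gr \<Sigma>')" "origin (gr \<Sigma>') (FA a) = origin (gr \<Sigma>') (fA a)"
      "terminus (gr \<Sigma>') (FA a) = terminus (gr \<Sigma>') (fA a)"
      using fA_ends[OF a] eV a by auto
    show "fA a \<in> arrows (gr \<Sigma>')" using bij_betwE[OF fA_bij] a by blast
  qed
  then show ?thesis using F eV unfolding over_simps by blast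
qed

end

theorem theorem5p6:
  fixes \<G> :: "('dv, 'da, 'g, 'x, 'h, 'y) gga"
    and \<Sigma> :: "('v, 'a, 'dv, 'da, 'x, 'y) scaf"
    and \<Sigma>' :: "('w, 'b, 'dv, 'da, 'x, 'y) scaf"
    and S\<^sub>0 :: "('v set, 'a set) rgraph"
    and S\<^sub>0' :: "('w set, 'b set) rgraph"
    and fV :: "'v \<Rightarrow> 'w" and fA :: "'a \<Rightarrow> 'b"
  assumes "is_gga \<G>"
    and "is_scaffolding \<G> \<Sigma>"
    and "is_scaffolding \<G> \<Sigma>'"
    and "is_subtree S\<^sub>0 (quot \<Sigma>)"
    and "is_subtree S\<^sub>0' (quot \<Sigma>')"
    and "partial_scaffolding_iso \<Sigma> S\<^sub>0 \<Sigma>' S\<^sub>0' fV fA"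
    and "acceptable \<G> \<Sigma> S\<^sub>0 \<Sigma>' fV"
  shows "\<exists>FV FA. scaffolding_iso \<Sigma> \<Sigma>' FV FA \<and>
    acceptable \<G> \<Sigma> (quot \<Sigma>) \<Sigma>' FV \<and>
    (\<forall>x \<in> vertices (over \<Sigma> S\<^sub>0). FV x = fV x) \<and>
    (\<forall>x \<in> arrows (over \<Sigma> S\<^sub>0). FA x = fA x)"
proof -
  interpret acceptable_partial_iso \<G> \<Sigma> \<Sigma>' S\<^sub>0 S\<^sub>0' fV fA
    using assms by unfold_locales
  show ?thesis by (rule acceptable_extension)
qed

end
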